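(* Let $\mu\in(0,\infty)$ be a fixed number and let $T\sim F_T$, $A\sim F_A$, $B\sim F_B$ be nonnegative random variables. Then, for a fixed constant $\lambda>0$, we have $$0\le \mathsf{E}[T]<1,\quad \mathsf{E}[A]=1/\lambda,\quad \mathsf{E}[A^2]<\infty\quad\text{and}\quad 0\le \mathsf{E}[B]<\infty$$ if and only if the functional equation $$\hat F(s)=\int_0^\infty\frac{1}{(1+\lambda\,\sigma_B(\sigma(s)))^{a}}\,\mathrm{d}F_A(a),\quad s\ge 0,$$ has exactly one solution $X\sim F$ (a distribution $F$ of a nonnegative random variable $X$) with mean $\mu$ and finite variance. Moreover, in this case, $$\mathsf{Var}[X]=\frac{\lambda^2\,\mathsf{Var}[A]+\lambda+\mathsf{E}[B]+\mathsf{E}[T]}{1-\mathsf{E}[T]}\,\mu^2 .$$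
   Context: For a nonnegative random variable $Y$, $Y\sim F_Y$ means that $Y$ has distribution function $F_Y$, and $\hat F_Y(s)=\mathsf{E}[e^{-sY}]=\int_0^\infty e^{-sy}\,\mathrm{d}F_Y(y)$, $s\ge0$, is its Laplace–Stieltjes transform. Integrals $\int_0^\infty$ with respect to distributions include a possible atom at $0$. For a distribution $F$ on $[0,\infty)$ with mean $\mu\in(0,\infty)$ (the unknown of the equation), define $$\sigma(s)=\int_0^\infty\frac{1-\hat F(ts)}{t}\,\mathrm{d}F_T(t),\quad s\ge0,$$ where the integrand at $t=0$ is defined by continuity to be $\mu s$. Equivalently, $\sigma(s)=\mu\int_0^s\hat F_{TZ}(x)\,\mathrm{d}x$, where $Z$ is independent of $T$ and has the length-biased distribution $F_Z(z)=\frac1\mu\int_0^z x\,\mathrm{d}F(x)$, $z\ge0$. Note that $\sigma$ depends on the unknown $F$. Define also $\sigma_B(s)=\int_0^s\hat F_B(t)\,\mathrm{d}t$, $s\ge0$. *)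

theory Defs
  imports "HOL-Probability.Probability"
begin

definition nonneg_distribution :: "real measure \<Rightarrow> bool" where
  "nonneg_distribution F \<longleftrightarrow> real_distribution F \<and> (AE x in F. 0 \<le> x)"

text \<open>\<open>X \<sim> F\<close> for a nonnegative random variable \<open>X\<close> on the probability space \<open>M\<close>.\<close>

definition nonneg_rv_dist :: "'a measure \<Rightarrow> ('a \<Rightarrow> real) \<Rightarrow> real measure \<Rightarrow> bool" where
  "nonneg_rv_dist M X F \<longleftrightarrow>
     X \<in> borel_measurable M \<and> (AE \<omega> in M. 0 \<le> X \<omega>) \<and> F = distr M borel X"

definition laplace_stieltjes :: "real measure \<Rightarrow> real \<Rightarrow> real" where
  "laplace_stieltjes F s = (\<integral>y. exp (- (s * y)) \<partial>F)"

text \<open>\<open>\<mu>\<close> is meant to be the mean of \<open>F\<close>; \<open>\<mu> * s\<close> is then the limit of the integrand as \<open>t\<close> tends to 0.\<close>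

definition sigma_fun :: "real measure \<Rightarrow> real \<Rightarrow> real measure \<Rightarrow> real \<Rightarrow> real" where
  "sigma_fun F\<^sub>T \<mu> F s =
     (\<integral>t. (if t = 0 then \<mu> * s else (1 - laplace_stieltjes F (t * s)) / t) \<partial>F\<^sub>T)"

definition sigma_B :: "real measure \<Rightarrow> real \<Rightarrow> real" where
  "sigma_B F\<^sub>B s = integral {0..s} (laplace_stieltjes F\<^sub>B)"

definition satisfies_equation ::
  "real measure \<Rightarrow> real measure \<Rightarrow> real measure \<Rightarrow> real \<Rightarrow> real \<Rightarrow> real measure \<Rightarrow> bool" where
  "satisfies_equation F\<^sub>T F\<^sub>A F\<^sub>B lam \<mu> F \<longleftrightarrow>
     (\<forall>s\<ge>0. laplace_stieltjes F s =
        (\<integral>a. 1 / (1 + lam * sigma_B F\<^sub>B (sigma_fun F\<^sub>T \<mu> F s)) powr a \<partial>F\<^sub>A))"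

definition is_solution ::
  "real measure \<Rightarrow> real measure \<Rightarrow> real measure \<Rightarrow> real \<Rightarrow> real \<Rightarrow> real measure \<Rightarrow> bool" where
  "is_solution F\<^sub>T F\<^sub>A F\<^sub>B lam \<mu> F \<longleftrightarrow>
     nonneg_distribution F \<and>
     integrable F (\<lambda>x. x) \<and> prob_space.expectation F (\<lambda>x. x) = \<mu> \<and>
     integrable F (\<lambda>x. (x - \<mu>)\<^sup>2) \<and>
     satisfies_equation F\<^sub>T F\<^sub>A F\<^sub>B lam \<mu> F"

end

theory Submission
  imports Defs "HOL-Real_Asymp.Real_Asymp"
begin

text \<open>
  The proof compares Taylor expansions of Laplace transforms at the origin and uses a contraction argument for
  transforms.

  Necessity. Put \<open>x = lam * sigma_B F\<^sub>B (sigma_fun F\<^sub>T \<mu> F s)\<close> and \<open>w = ln (1 + x)\<close>. The equation says that the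
  transform of \<open>F\<close> at \<open>s\<close> is the transform of \<open>A\<close> at \<open>w\<close>, and \<open>w\<close> behaves like \<open>lam * \<mu> * s\<close> near 0; comparing first
  order terms gives \<open>E A = 1 / lam\<close>. The second-order remainder of the transform of \<open>F\<close> is then a sum of
  four nonnegative remainders: those of the transform of \<open>A\<close>, of sigma, of sigma-B and of the logarithm. After division
  by \<open>s\<^sup>2\<close> the left-hand side stays bounded, so by Fatou's lemma \<open>E A\<^sup>2\<close>, \<open>E T\<close> and \<open>E B\<close> are finite, and in the limit
  \<open>E X\<^sup>2 = E T * E X\<^sup>2 + \<mu>\<^sup>2 * (E B + lam + lam\<^sup>2 * E A\<^sup>2)\<close>.
  Since the last summand is positive, \<open>E T < 1\<close>, and solving for \<open>E X\<^sup>2\<close> gives the variance. All of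
  this (\<open>moments_from_solution\<close>) applies to an arbitrary solution.

  Sufficiency. Let \<open>K\<close> be the value of \<open>E X\<^sup>2\<close> determined by the identity. The same expansion, read as an upper bound,
  shows that the right-hand side of the equation preserves the estimate
  \<open>0 \<le> \<phi> s - 1 + \<mu> * s \<le> K / 2 * s\<^sup>2\<close>, which characterizes mean \<open>\<mu>\<close> and second moment at most \<open>K\<close>
  (\<open>moment_classD\<close>, \<open>moment_classI\<close>). In the distance \<open>sup \<bar>\<phi> s - \<psi> s\<bar> / s\<^sup>2\<close> the right-hand side is a contraction with
  factor \<open>E T\<close> (\<open>solution_map_contraction\<close>). This gives uniqueness of the transform, hence of the distribution
  (\<open>laplace_unique\<close>), and convergence of the iterates.

  The iterates have to be transforms of distributions again. This is a matter of Bernstein functions: sigma,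
  sigma-B and the logarithm are Laplace exponents of infinitely divisible distributions, such exponents are closed under
  composition, and the transform of \<open>A\<close> at an exponent is the transform of a subordinated process
  (\<open>laplace_class_subordination\<close>). Everything here follows from the closure of the set of transforms under
  mixtures and under limits that are continuous at 0. The three exponents are treated at once, since sigma-B is
  sigma for the unit mass at 1 and the logarithm is sigma-B for an exponential variable.
\<close>

section \<open>Laplace transforms of distributions on the half-line\<close>

lemma nonneg_distributionD:
  assumes "nonneg_distribution F"
  shows "prob_space F" "sets F = sets borel" "space F = UNIV" "AE x in F. 0 \<le> x" "real_distribution F"
    "measure F UNIV = 1"
proof -
  interpret real_distribution F using assms by (simp add: nonneg_distribution_def)
  show "prob_space F" by unfold_locales
  show "sets F = sets borel" "space F = UNIV" by auto
  show "measure F UNIV = 1" using prob_space unfolding space_eq_univ .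
  show "AE x in F. 0 \<le> x" "real_distribution F" using assms by (auto simp: nonneg_distribution_def)
qed

lemma nonneg_distributionI:
  assumes "prob_space F" "sets F = sets borel" "AE x in F. 0 \<le> x"
  shows "nonneg_distribution F"
proof -
  interpret prob_space F by fact
  show ?thesis using assms sets_eq_imp_space_eq[OF assms(2)]
    by (auto simp: nonneg_distribution_def real_distribution_def real_distribution_axioms_def)
qed

lemma integrable_laplace:
  assumes F: "nonneg_distribution F" and "0 \<le> s"
  shows "integrable F (\<lambda>y. exp (- (s * y)))"
proof -
  interpret real_distribution F using F by (rule nonneg_distributionD)
  show ?thesis
  proof (rule integrable_const_bound[of _ 1])
    show "AE y in F. norm (exp (- (s * y))) \<le> 1"
      using nonneg_distributionD(4)[OF F] by eventually_elim (use \<open>0 \<le> s\<close> in auto)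
  qed measurable
qed

lemma laplace_nonneg: "0 \<le> laplace_stieltjes F s"
  by (simp add: laplace_stieltjes_def)

lemma laplace_0: "nonneg_distribution F \<Longrightarrow> laplace_stieltjes F 0 = 1"
  using nonneg_distributionD(1)[of F] by (simp add: laplace_stieltjes_def prob_space.prob_space)

lemma laplace_antimono:
  assumes F: "nonneg_distribution F" and "0 \<le> s" "s \<le> t"
  shows "laplace_stieltjes F t \<le> laplace_stieltjes F s"
  unfolding laplace_stieltjes_def
proof (rule integral_mono_AE)
  show "AE y in F. exp (- (t * y)) \<le> exp (- (s * y))"
    using nonneg_distributionD(4)[OF F] by eventually_elim (use assms in \<open>auto intro: mult_right_mono\<close>)
qed (use assms in \<open>auto intro: integrable_laplace\<close>)

lemma laplace_le_1: "nonneg_distribution F \<Longrightarrow> 0 \<le> s \<Longrightarrow> laplace_stieltjes F s \<le> 1"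
  using laplace_antimono[of F 0 s] by (simp add: laplace_0)

lemma nn_integral_laplace:
  assumes F: "nonneg_distribution F" and "0 \<le> s"
  shows "(\<integral>\<^sup>+y. ennreal (exp (- (s * y))) \<partial>F) = ennreal (laplace_stieltjes F s)"
  unfolding laplace_stieltjes_def using integrable_laplace[OF assms]
  by (subst nn_integral_eq_integral) auto

lemma laplace_LIMSEQ:
  assumes F: "nonneg_distribution F" and x: "\<And>n. 0 \<le> x n" and "0 \<le> a" "x \<longlonglongrightarrow> a"
  shows "(\<lambda>n. laplace_stieltjes F (x n)) \<longlonglongrightarrow> laplace_stieltjes F a"
  unfolding laplace_stieltjes_def
proof (rule integral_dominated_convergence[where w="\<lambda>_. 1"])
  interpret real_distribution F using F by (rule nonneg_distributionD)
  show "integrable F (\<lambda>_. 1::real)" by simp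
  show "(\<lambda>y. exp (- (a * y))) \<in> borel_measurable F" by measurable
  show "(\<lambda>y. exp (- (x n * y))) \<in> borel_measurable F" for n by measurable
  show "AE y in F. (\<lambda>n. exp (- (x n * y))) \<longlonglongrightarrow> exp (- (a * y))"
    by (auto intro!: tendsto_intros assms)
  show "AE y in F. norm (exp (- (x n * y))) \<le> 1" for n
    using nonneg_distributionD(4)[OF F] by eventually_elim (use x[of n] in auto)
qed

lemma continuous_on_laplace:
  "nonneg_distribution F \<Longrightarrow> continuous_on {0..} (laplace_stieltjes F)"
  unfolding continuous_on_sequentially comp_def by (auto intro: laplace_LIMSEQ)

lemma measurable_laplace [measurable]:
  assumes F: "nonneg_distribution F"
  shows "laplace_stieltjes F \<in> borel_measurable borel"
proof -
  interpret real_distribution F using F by (rule nonneg_distributionD)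
  show ?thesis unfolding laplace_stieltjes_def by measurable
qed

section \<open>Closure properties of the class of Laplace transforms\<close>

text \<open>Working with the set of transforms instead of the distributions themselves reduces the construction of
  new distributions to showing that a function belongs to a set with good closure properties.\<close>

definition laplace_class :: "(real \<Rightarrow> real) \<Rightarrow> bool" where
  "laplace_class \<phi> \<longleftrightarrow> (\<exists>F. nonneg_distribution F \<and> (\<forall>s\<ge>0. laplace_stieltjes F s = \<phi> s))"

lemma laplace_classD:
  assumes "laplace_class \<phi>"
  shows "\<phi> 0 = 1" "0 \<le> s \<Longrightarrow> 0 \<le> \<phi> s" "0 \<le> s \<Longrightarrow> \<phi> s \<le> 1" "continuous_on {0..} \<phi>"
    "0 \<le> s \<Longrightarrow> s \<le> t \<Longrightarrow> \<phi> t \<le> \<phi> s"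
proof -
  obtain F where F: "nonneg_distribution F" and eq: "\<And>s. 0 \<le> s \<Longrightarrow> laplace_stieltjes F s = \<phi> s"
    using assms by (auto simp: laplace_class_def)
  show "\<phi> 0 = 1" using laplace_0[OF F] eq[of 0] by simp
  show "0 \<le> s \<Longrightarrow> 0 \<le> \<phi> s" using laplace_nonneg[of F s] eq[of s] by simp
  show "0 \<le> s \<Longrightarrow> \<phi> s \<le> 1" using laplace_le_1[OF F, of s] eq[of s] by simp
  show "0 \<le> s \<Longrightarrow> s \<le> t \<Longrightarrow> \<phi> t \<le> \<phi> s" using laplace_antimono[OF F, of s t] eq by simp
  show "continuous_on {0..} \<phi>"
    using continuous_on_laplace[OF F] by (rule continuous_on_eq) (simp add: eq)
qed

lemma laplace_class_tendsto_1:
  assumes "laplace_class \<phi>"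
  shows "(\<phi> \<longlongrightarrow> 1) (at_right 0)"
proof -
  have "(\<phi> \<longlongrightarrow> \<phi> 0) (at 0 within {0..})"
    using laplace_classD(4)[OF assms] by (auto simp: continuous_on_def)
  then have "(\<phi> \<longlongrightarrow> \<phi> 0) (at_right 0)"
    by (rule tendsto_within_subset) auto
  then show ?thesis by (simp add: laplace_classD(1)[OF assms])
qed

lemma laplace_class_cong:
  "laplace_class \<phi> \<Longrightarrow> (\<And>s. 0 \<le> s \<Longrightarrow> \<phi> s = \<psi> s) \<Longrightarrow> laplace_class \<psi>"
  by (auto simp: laplace_class_def)

text \<open>A Chernoff-type bound: since \<open>exp (-1) \<le> 1/2\<close>, the function \<open>2 * (1 - exp (- s * x))\<close> is at least 1 for
  \<open>x > 1/s\<close>. It turns equicontinuity of the transforms at 0 into tightness of the distributions.\<close>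

lemma laplace_tail_bound:
  assumes F: "nonneg_distribution F" and s: "0 < s"
  shows "1 - 2 * (1 - laplace_stieltjes F s) \<le> measure F {-1<..1/s}"
proof -
  interpret real_distribution F using F by (rule nonneg_distributionD)
  have e: "exp (-1) \<le> (1/2::real)"
    using exp_ge_add_one_self[of "1::real"] by (simp add: exp_minus field_simps)
  have "1 - measure F {-1<..1/s} = (\<integral>x. 1 - indicator {-1<..1/s} x \<partial>F)"
    by (subst Bochner_Integration.integral_diff)
      (auto simp: emeasure_eq_measure nonneg_distributionD(6)[OF F, simplified])
  also have "\<dots> \<le> (\<integral>x. 2 * (1 - exp (- (s * x))) \<partial>F)"
  proof (rule integral_mono_AE)
    show "integrable F (\<lambda>x. 1 - indicator {-1<..1/s} x :: real)"
      by (auto simp: emeasure_eq_measure)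
    show "integrable F (\<lambda>x. 2 * (1 - exp (- (s * x))))"
      using integrable_laplace[OF F, of s] s by auto
    show "AE x in F. 1 - indicator {-1<..1/s} x \<le> 2 * (1 - exp (- (s * x)))"
      using nonneg_distributionD(4)[OF F]
    proof eventually_elim
      case (elim x)
      show ?case
      proof (cases "x \<le> 1/s")
        case True
        then show ?thesis using elim s by auto
      next
        case False
        then have "1 \<le> s * x" using s by (simp add: field_simps)
        then have "exp (- (s * x)) \<le> exp (-1)" by simp
        from order_trans[OF this e] show ?thesis using False by simp
      qed
    qed
  qed
  also have "\<dots> = 2 * (1 - laplace_stieltjes F s)"
    using integrable_laplace[OF F, of s] s by (simp add: laplace_stieltjes_def nonneg_distributionD(6)[OF F])
  finally show ?thesis by simp
qed

text \<open>The continuity theorem for Laplace transforms. Continuity of the limit at 0 excludes loss of mass at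
  infinity: by the tail bound one \<open>s > 0\<close> serves all \<open>n\<close>, so the distributions are tight, and any weak limit point has
  the limit function as its transform.\<close>

lemma laplace_class_limit:
  assumes \<phi>: "\<And>n. laplace_class (\<phi> n)"
    and lim: "\<And>s. 0 \<le> s \<Longrightarrow> (\<lambda>n. \<phi> n s) \<longlonglongrightarrow> \<psi> s"
    and cont: "(\<psi> \<longlongrightarrow> 1) (at_right 0)"
  shows "laplace_class \<psi>"
proof -
  obtain F where F: "\<And>n. nonneg_distribution (F n)"
    and LF: "\<And>n s. 0 \<le> s \<Longrightarrow> laplace_stieltjes (F n) s = \<phi> n s"
    using \<phi> unfolding laplace_class_def by metis
  have RD: "real_distribution (F n)" for n using F by (rule nonneg_distributionD)
  have "tight F"
    unfolding tight_def
  proof (intro conjI allI impI RD)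
    fix e :: real assume e: "0 < e"
    (* One point s0 works for all large n because psi is close to 1 there; the finitely many
       remaining n are handled by decreasing s, which only increases every transform. *)
    have "eventually (\<lambda>s. 1 - e / 4 < \<psi> s) (at_right 0)"
      using order_tendstoD(1)[OF cont, of "1 - e/4"] e by simp
    then obtain s0 where s0: "0 < s0" "1 - e / 4 < \<psi> s0"
      using eventually_happens'[OF trivial_limit_at_right_real eventually_conj[OF eventually_at_right_less[of 0]]]
      by auto
    obtain N where N: "\<And>n. N \<le> n \<Longrightarrow> 1 - e / 4 < \<phi> n s0"
      using order_tendstoD(1)[OF lim s0(2)] s0(1) by (auto simp: eventually_sequentially)
    have "eventually (\<lambda>s. \<forall>n\<in>{..<N}. 1 - e / 4 < \<phi> n s) (at_right 0)"
    proof (intro eventually_ball_finite ballI)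
      fix n show "eventually (\<lambda>s. 1 - e / 4 < \<phi> n s) (at_right 0)"
        using order_tendstoD(1)[OF laplace_class_tendsto_1[OF \<phi>], of "1 - e/4"] e by simp
    qed simp
    moreover have "eventually (\<lambda>s. s \<in> {0<..<s0}) (at_right 0)"
      using s0(1) by (rule eventually_at_right_real)
    ultimately have "eventually (\<lambda>s. (\<forall>n\<in>{..<N}. 1 - e / 4 < \<phi> n s) \<and> s \<in> {0<..<s0}) (at_right 0)"
      by (rule eventually_conj)
    then obtain s where s: "\<And>n. n < N \<Longrightarrow> 1 - e / 4 < \<phi> n s" "0 < s" "s < s0"
      using eventually_happens'[OF trivial_limit_at_right_real] by fastforce
    have *: "1 - e / 4 < \<phi> n s" for n
    proof (cases "n < N")
      case False
      have "\<phi> n s0 \<le> \<phi> n s" using laplace_classD(5)[OF \<phi>, of s s0 n] s by simp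
      then show ?thesis using N[of n] False by simp
    qed (use s in auto)
    have "1 - e < measure (F n) {-1<..1/s}" for n
      using laplace_tail_bound[OF F[of n] s(2)] LF[of s n] s(2) e *[of n]
      by (simp add: field_simps)
    moreover have "-1 < 1 / s" using s(2) by (simp add: field_simps)
    ultimately show "\<exists>a b. a < b \<and> (\<forall>n. 1 - e < measure (F n) {a<..b})" by blast
  qed
  from tight_imp_convergent_subsubsequence[OF this, of id]
  obtain r M where r: "strict_mono r" and M: "real_distribution M" and wc: "weak_conv_m (F \<circ> r) M"
    by (auto simp: strict_mono_id)
  interpret M: real_distribution M by fact
  have conv: "(\<lambda>n. integral\<^sup>L (F (r n)) f) \<longlonglongrightarrow> integral\<^sup>L M f"
    if "\<And>x. isCont f x" "\<And>x. norm (f x) \<le> 1" for f :: "real \<Rightarrow> real"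
    using weak_conv_imp_integral_bdd_continuous_conv[OF _ M wc that] RD by (simp add: comp_def)
  have "AE x in M. 0 \<le> x"
  proof -
    (* A bounded continuous function that is positive exactly on the negative half-line. *)
    let ?h = "\<lambda>x::real. max 0 (min 1 (-x))"
    have "(\<lambda>n. integral\<^sup>L (F (r n)) ?h) \<longlonglongrightarrow> integral\<^sup>L M ?h"
      by (rule conv) (auto intro!: continuous_intros)
    moreover have "integral\<^sup>L (F (r n)) ?h = 0" for n
    proof (rule integral_eq_zero_AE)
      show "AE x in F (r n). ?h x = 0"
        using nonneg_distributionD(4)[OF F[of "r n"]] by eventually_elim auto
    qed
    ultimately have "integral\<^sup>L M ?h = 0" by (simp add: LIMSEQ_const_iff)
    moreover have "integrable M ?h"
      by (rule M.integrable_const_bound[of _ 1]) auto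
    ultimately have "AE x in M. ?h x = 0"
      by (subst (asm) integral_nonneg_eq_0_iff_AE) auto
    then show ?thesis by eventually_elim (auto simp: max_def min_def split: if_splits)
  qed
  then have M': "nonneg_distribution M" using M by (simp add: nonneg_distribution_def)
  have "laplace_stieltjes M s = \<psi> s" if s: "0 \<le> s" for s
  proof -
    let ?g = "\<lambda>x::real. exp (- (s * max 0 x))"
    have *: "integral\<^sup>L G ?g = laplace_stieltjes G s" if "nonneg_distribution G" for G
      unfolding laplace_stieltjes_def
    proof (rule integral_cong_AE)
      note [measurable_cong] = nonneg_distributionD(2)[OF that]
      show "?g \<in> borel_measurable G" "(\<lambda>y. exp (- (s * y))) \<in> borel_measurable G" by measurable
      show "AE x in G. ?g x = exp (- (s * x))"
        using nonneg_distributionD(4)[OF that] by eventually_elim auto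
    qed
    have "(\<lambda>n. integral\<^sup>L (F (r n)) ?g) \<longlonglongrightarrow> integral\<^sup>L M ?g"
      by (rule conv) (use s in \<open>auto intro!: continuous_intros\<close>)
    then have "(\<lambda>n. \<phi> (r n) s) \<longlonglongrightarrow> laplace_stieltjes M s"
      using s by (simp add: * F M' LF)
    moreover have "(\<lambda>n. \<phi> (r n) s) \<longlonglongrightarrow> \<psi> s"
      using LIMSEQ_subseq_LIMSEQ[OF lim[OF s] r] by (simp add: comp_def)
    ultimately show ?thesis by (rule LIMSEQ_unique)
  qed
  then show ?thesis using M' by (auto simp: laplace_class_def)
qed

text \<open>For countably many components every choice of component distributions is a measurable kernel, so the
  mixture exists as a monadic bind. Continuous mixtures are obtained as limits of these, so that measurability of a
  family of distributions never has to be checked.\<close>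

lemma laplace_class_mixture_nat:
  fixes k :: "'b \<Rightarrow> nat"
  assumes P: "prob_space P" and k [measurable]: "k \<in> measurable P (count_space UNIV)"
    and \<phi>: "\<And>n. laplace_class (\<phi> n)"
  shows "laplace_class (\<lambda>s. \<integral>y. \<phi> (k y) s \<partial>P)"
proof -
  interpret P: prob_space P by fact
  obtain F where F: "\<And>n. nonneg_distribution (F n)"
    and LF: "\<And>n s. 0 \<le> s \<Longrightarrow> laplace_stieltjes (F n) s = \<phi> n s"
    using \<phi> unfolding laplace_class_def by metis
  note FD = nonneg_distributionD[OF F]
  have Fs: "F n \<in> space (subprob_algebra borel)" for n
    using FD by (simp add: space_subprob_algebra prob_space_imp_subprob_space)
  have K [measurable]: "(\<lambda>y. F (k y)) \<in> measurable P (subprob_algebra borel)"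
    by (rule measurable_compose[OF k]) (simp add: Fs)
  let ?G = "P \<bind> (\<lambda>y. F (k y))"
  have G: "nonneg_distribution ?G"
  proof (rule nonneg_distributionI)
    show "prob_space ?G" by (rule P.prob_space_bind[OF _ K]) (simp add: FD)
    show "sets ?G = sets borel" by (rule sets_bind) (auto simp: FD P.not_empty)
    show "AE x in ?G. 0 \<le> x" by (subst AE_bind[OF K]) (auto simp: FD)
  qed
  have "laplace_stieltjes ?G s = (\<integral>y. \<phi> (k y) s \<partial>P)" if s: "0 \<le> s" for s
  proof -
    have int: "integrable P (\<lambda>y. \<phi> (k y) s)"
      by (rule P.integrable_const_bound[of _ 1])
        (use s in \<open>auto simp: laplace_classD[OF \<phi>] intro!: measurable_compose[OF k]\<close>)
    have "ennreal (laplace_stieltjes ?G s) = (\<integral>\<^sup>+y. \<integral>\<^sup>+x. ennreal (exp (- (s * x))) \<partial>F (k y) \<partial>P)"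
      using s by (subst nn_integral_laplace[OF G, symmetric]) (auto intro!: nn_integral_bind[OF _ K])
    also have "\<dots> = (\<integral>\<^sup>+y. ennreal (\<phi> (k y) s) \<partial>P)"
      using s by (simp add: nn_integral_laplace[OF F] LF)
    also have "\<dots> = ennreal (\<integral>y. \<phi> (k y) s \<partial>P)"
      using s by (intro nn_integral_eq_integral int) (auto simp: laplace_classD[OF \<phi>])
    finally show ?thesis
      by (subst (asm) ennreal_inj) (auto simp: laplace_nonneg laplace_classD[OF \<phi>] s intro!: integral_nonneg_AE)
  qed
  then show ?thesis using G by (auto simp: laplace_class_def)
qed

lemma laplace_class_convex:
  assumes "laplace_class \<phi>" "laplace_class \<psi>" "0 \<le> p" "p \<le> 1"
  shows "laplace_class (\<lambda>s. p * \<phi> s + (1 - p) * \<psi> s)"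
proof -
  have "laplace_class (\<lambda>s. \<integral>b. (if of_bool b = (1::nat) then \<phi> else \<psi>) s \<partial>measure_pmf (bernoulli_pmf p))"
    by (rule laplace_class_mixture_nat) (auto simp: assms measure_pmf.prob_space_axioms)
  then show ?thesis by (rule laplace_class_cong) (use assms in simp)
qed

text \<open>Rounding the mixing parameter \<open>y\<close> down to a multiple of \<open>1 / (n + 1)\<close> gives countable mixtures that
  converge to the continuous one by dominated convergence.\<close>

lemma laplace_class_mixture:
  assumes P: "nonneg_distribution P"
    and g: "\<And>y. 0 \<le> y \<Longrightarrow> laplace_class (g y)"
    and cont: "\<And>s. 0 \<le> s \<Longrightarrow> continuous_on {0..} (\<lambda>y. g y s)"
    and meas: "\<And>s. 0 \<le> s \<Longrightarrow> (\<lambda>y. g y s) \<in> borel_measurable borel"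
  shows "laplace_class (\<lambda>s. \<integral>y. g y s \<partial>P)"
proof (rule laplace_class_limit)
  interpret real_distribution P using P by (rule nonneg_distributionD)
  define k where "k n y = nat \<lfloor>real (Suc n) * y\<rfloor>" for n and y :: real
  have k [measurable]: "k n \<in> measurable P (count_space UNIV)" for n
    unfolding k_def by measurable
  show "laplace_class (\<lambda>s. \<integral>y. g (real (k n y) / real (Suc n)) s \<partial>P)" for n
    by (rule laplace_class_mixture_nat[OF _ k, where \<phi>="\<lambda>m. g (real m / real (Suc n))"])
      (auto intro!: g prob_space_axioms)
  have gm [measurable]: "(\<lambda>y. g y s) \<in> borel_measurable P" if "0 \<le> s" for s
    using meas[OF that] by measurable
  have gb: "\<bar>g y s\<bar> \<le> 1" if "0 \<le> s" "0 \<le> y" for s y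
    using laplace_classD(2,3)[OF g] that by auto
  show "(\<lambda>n. \<integral>y. g (real (k n y) / real (Suc n)) s \<partial>P) \<longlonglongrightarrow> (\<integral>y. g y s \<partial>P)" if s: "0 \<le> s" for s
  proof (rule integral_dominated_convergence[where w="\<lambda>_. 1"])
    show "(\<lambda>y. g (real (k n y) / real (Suc n)) s) \<in> borel_measurable P" for n
      by (rule measurable_compose[OF k]) simp
    show "AE y in P. norm (g (real (k n y) / real (Suc n)) s) \<le> 1" for n
      using gb[OF s] by auto
    show "AE y in P. (\<lambda>n. g (real (k n y) / real (Suc n)) s) \<longlonglongrightarrow> g y s"
      using nonneg_distributionD(4)[OF P]
    proof eventually_elim
      case (elim y)
      have "(\<lambda>n. real (k n y) / real (Suc n)) \<longlonglongrightarrow> y"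
      proof (rule real_tendsto_sandwich)
        show "eventually (\<lambda>n. y - 1 / real (Suc n) \<le> real (k n y) / real (Suc n)) sequentially"
        proof (intro always_eventually allI)
          fix n
          have "real (Suc n) * y - 1 \<le> real (k n y)"
            unfolding k_def by linarith
          then have "(real (Suc n) * y - 1) / real (Suc n) \<le> real (k n y) / real (Suc n)"
            by (rule divide_right_mono) simp
          then show "y - 1 / real (Suc n) \<le> real (k n y) / real (Suc n)"
            by (simp add: diff_divide_distrib)
        qed
        show "eventually (\<lambda>n. real (k n y) / real (Suc n) \<le> y) sequentially"
        proof (intro always_eventually allI)
          fix n
          have "real (k n y) \<le> real (Suc n) * y"
            unfolding k_def using elim by simp
          then show "real (k n y) / real (Suc n) \<le> y"
            by (simp add: field_simps)
        qed
        show "(\<lambda>n. y - 1 / real (Suc n)) \<longlonglongrightarrow> y"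
          using tendsto_diff[OF tendsto_const LIMSEQ_inverse_real_of_nat, of y] by (simp add: inverse_eq_divide)
      qed simp
      then show ?case
        using cont[OF s] elim unfolding continuous_on_sequentially comp_def by simp
    qed
  qed (use s in auto)
  show "((\<lambda>s. \<integral>y. g y s \<partial>P) \<longlongrightarrow> 1) (at_right 0)"
  proof (rule tendsto_at_right_sequentially[of 0 1])
    fix S :: "nat \<Rightarrow> real" assume S: "\<And>n. 0 < S n" "S \<longlonglongrightarrow> 0"
    have S': "filterlim S (at_right 0) sequentially"
      using S by (auto simp: filterlim_at less_imp_neq[THEN not_sym])
    have "(\<lambda>n. \<integral>y. g y (S n) \<partial>P) \<longlonglongrightarrow> (\<integral>y. 1 \<partial>P)"
    proof (rule integral_dominated_convergence[where w="\<lambda>_. 1"])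
      show "(\<lambda>y. g y (S n)) \<in> borel_measurable P" for n
        using S(1)[of n] by simp
      show "AE y in P. norm (g y (S n)) \<le> 1" for n
        using nonneg_distributionD(4)[OF P] by eventually_elim (use gb S(1)[of n] in auto)
      show "AE y in P. (\<lambda>n. g y (S n)) \<longlonglongrightarrow> 1"
        using nonneg_distributionD(4)[OF P]
        by eventually_elim (rule filterlim_compose[OF laplace_class_tendsto_1[OF g] S'])
    qed auto
    then show "(\<lambda>n. \<integral>y. g y (S n) \<partial>P) \<longlonglongrightarrow> 1" by (simp add: nonneg_distributionD(6)[OF P])
  qed simp
qed

lemma nonneg_distribution_return:
  "0 \<le> c \<Longrightarrow> nonneg_distribution (return borel c)"
  by (rule nonneg_distributionI) (auto simp: prob_space_return AE_return)

lemma laplace_return: "laplace_stieltjes (return borel c) s = exp (- (s * c))"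
  unfolding laplace_stieltjes_def by (subst integral_return) auto

lemma laplace_class_exp: "0 \<le> c \<Longrightarrow> laplace_class (\<lambda>s. exp (- (s * c)))"
  unfolding laplace_class_def
  by (intro exI[of _ "return borel c"]) (simp add: nonneg_distribution_return laplace_return)

lemma laplace_class_1: "laplace_class (\<lambda>s. 1)"
  using laplace_class_exp[of 0] by simp

lemma laplace_class_shift:
  assumes "laplace_class \<phi>" "0 \<le> c"
  shows "laplace_class (\<lambda>s. exp (- (s * c)) * \<phi> s)"
proof -
  obtain F where F: "nonneg_distribution F" and eq: "\<And>s. 0 \<le> s \<Longrightarrow> laplace_stieltjes F s = \<phi> s"
    using assms by (auto simp: laplace_class_def)
  interpret real_distribution F using F by (rule nonneg_distributionD)
  have "nonneg_distribution (distr F borel (\<lambda>x. x + c))"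
  proof (rule nonneg_distributionI)
    show "AE x in distr F borel (\<lambda>x. x + c). 0 \<le> x"
      using nonneg_distributionD(4)[OF F] by (subst AE_distr_iff) (use assms in auto)
  qed (auto intro!: prob_space_distr)
  moreover have "exp (- (s * (x + c))) = exp (- (s * c)) * exp (- (s * x))" for s x
    by (simp add: exp_add[symmetric] algebra_simps)
  then have "laplace_stieltjes (distr F borel (\<lambda>x. x + c)) s = exp (- (s * c)) * \<phi> s" if "0 \<le> s" for s
    using eq[OF that] unfolding laplace_stieltjes_def
    by (subst integral_distr) auto
  ultimately show ?thesis by (auto simp: laplace_class_def)
qed

lemma laplace_class_scale:
  assumes "laplace_class \<phi>" "0 \<le> c"
  shows "laplace_class (\<lambda>s. \<phi> (c * s))"
proof -
  obtain F where F: "nonneg_distribution F" and eq: "\<And>s. 0 \<le> s \<Longrightarrow> laplace_stieltjes F s = \<phi> s"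
    using assms by (auto simp: laplace_class_def)
  interpret real_distribution F using F by (rule nonneg_distributionD)
  have "nonneg_distribution (distr F borel (\<lambda>x. c * x))"
  proof (rule nonneg_distributionI)
    show "AE x in distr F borel (\<lambda>x. c * x). 0 \<le> x"
      using nonneg_distributionD(4)[OF F] by (subst AE_distr_iff) (use assms in auto)
  qed (auto intro!: prob_space_distr)
  moreover have "laplace_stieltjes (distr F borel (\<lambda>x. c * x)) s = \<phi> (c * s)" if "0 \<le> s" for s
    using eq[of "c * s"] assms that unfolding laplace_stieltjes_def
    by (subst integral_distr) (auto simp: ac_simps)
  ultimately show ?thesis by (auto simp: laplace_class_def)
qed

text \<open>A product of transforms is the mixture, over a variable with the first transform, of shifts of a variable
  with the second.\<close>

lemma laplace_class_mult:
  assumes "laplace_class \<phi>" "laplace_class \<psi>"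
  shows "laplace_class (\<lambda>s. \<phi> s * \<psi> s)"
proof -
  obtain P where P: "nonneg_distribution P" and eq: "\<And>s. 0 \<le> s \<Longrightarrow> laplace_stieltjes P s = \<phi> s"
    using assms by (auto simp: laplace_class_def)
  have "laplace_class (\<lambda>s. \<integral>y. exp (- (s * y)) * \<psi> s \<partial>P)"
    by (rule laplace_class_mixture[OF P]) (auto intro!: laplace_class_shift assms continuous_intros)
  then show ?thesis
    by (rule laplace_class_cong) (simp add: eq[symmetric] laplace_stieltjes_def)
qed

lemma laplace_class_power: "laplace_class \<phi> \<Longrightarrow> laplace_class (\<lambda>s. \<phi> s ^ n)"
  by (induction n) (auto intro!: laplace_class_mult laplace_class_1)

section \<open>Laplace exponents of infinitely divisible distributions\<close>

text \<open>These are the Bernstein functions vanishing at 0 (Laplace exponents of subordinators), described by the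
  property that is used: \<open>exp (- a * \<psi>)\<close> is the transform of a distribution for every time \<open>a \<ge> 0\<close>.\<close>

definition laplace_exponent :: "(real \<Rightarrow> real) \<Rightarrow> bool" where
  "laplace_exponent \<psi> \<longleftrightarrow> (\<forall>a\<ge>0. laplace_class (\<lambda>s. exp (- (a * \<psi> s))))"

lemma laplace_exponent_cong:
  assumes "laplace_exponent \<psi>" "\<And>s. 0 \<le> s \<Longrightarrow> \<psi> s = \<eta> s"
  shows "laplace_exponent \<eta>"
  unfolding laplace_exponent_def
proof (intro allI impI)
  fix a :: real assume "0 \<le> a"
  then have "laplace_class (\<lambda>s. exp (- (a * \<psi> s)))"
    using assms(1) by (simp add: laplace_exponent_def)
  then show "laplace_class (\<lambda>s. exp (- (a * \<eta> s)))"
    by (rule laplace_class_cong) (simp add: assms(2))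
qed

lemma laplace_exponent_nonneg:
  assumes "laplace_exponent \<psi>" "0 \<le> s"
  shows "0 \<le> \<psi> s"
proof -
  have "laplace_class (\<lambda>s. exp (- (1 * \<psi> s)))"
    using assms(1) unfolding laplace_exponent_def by (metis zero_le_one)
  from laplace_classD(3)[OF this assms(2)] show ?thesis by simp
qed

lemma laplace_exponent_scale:
  assumes "laplace_exponent \<psi>" "0 \<le> c"
  shows "laplace_exponent (\<lambda>s. c * \<psi> s)"
  unfolding laplace_exponent_def
proof (intro allI impI)
  fix a :: real assume "0 \<le> a"
  then have "laplace_class (\<lambda>s. exp (- ((a * c) * \<psi> s)))"
    using assms by (simp add: laplace_exponent_def)
  then show "laplace_class (\<lambda>s. exp (- (a * (c * \<psi> s))))" by (simp add: mult.assoc)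
qed

lemma laplace_exponent_limit:
  assumes \<psi>: "\<And>n. laplace_exponent (\<psi> n)"
    and lim: "\<And>s. 0 \<le> s \<Longrightarrow> (\<lambda>n. \<psi> n s) \<longlonglongrightarrow> \<eta> s"
    and cont: "(\<eta> \<longlongrightarrow> 0) (at_right 0)"
  shows "laplace_exponent \<eta>"
  unfolding laplace_exponent_def
proof (intro allI impI)
  fix a :: real assume "0 \<le> a"
  show "laplace_class (\<lambda>s. exp (- (a * \<eta> s)))"
  proof (rule laplace_class_limit)
    show "laplace_class (\<lambda>s. exp (- (a * \<psi> n s)))" for n
      using \<psi> \<open>0 \<le> a\<close> by (simp add: laplace_exponent_def)
    show "(\<lambda>n. exp (- (a * \<psi> n s))) \<longlonglongrightarrow> exp (- (a * \<eta> s))" if "0 \<le> s" for s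
      by (intro tendsto_intros lim that)
    have "((\<lambda>s. exp (- (a * \<eta> s))) \<longlongrightarrow> exp (- (a * 0))) (at_right 0)"
      by (intro tendsto_intros cont)
    then show "((\<lambda>s. exp (- (a * \<eta> s))) \<longlongrightarrow> 1) (at_right 0)" by simp
  qed
qed

text \<open>The transform of a compound Poisson variable, obtained as the limit of \<open>(1 - q + q * h s) ^ n\<close> with
  \<open>n * q\<close> constant: each factor mixes the jump distribution with a unit mass at 0.\<close>

lemma laplace_exponent_compound_poisson:
  assumes h: "laplace_class h" and "0 \<le> c"
  shows "laplace_exponent (\<lambda>s. c * (1 - h s))"
  unfolding laplace_exponent_def
proof (intro allI impI)
  fix a :: real assume "0 \<le> a"
  define d where "d = a * c"
  have d: "0 \<le> d" using \<open>0 \<le> a\<close> \<open>0 \<le> c\<close> by (simp add: d_def)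
  (* Only indices above d make q = d / n a probability, so the sequence starts at Suc N. *)
  obtain N :: nat where N: "d \<le> real N" using real_arch_simple by blast
  show "laplace_class (\<lambda>s. exp (- (a * (c * (1 - h s)))))"
  proof (rule laplace_class_limit)
    fix n
    define q where "q = d / real (n + Suc N)"
    have q: "0 \<le> q" "q \<le> 1" using d N by (auto simp: q_def)
    have "1 + - (d * (1 - h s)) / real (n + Suc N) = q * h s + (1 - q) * 1" for s
    proof -
      have "- (d * (1 - h s)) / real (n + Suc N) = - (q * (1 - h s))"
        by (simp add: q_def)
      then show ?thesis by (simp add: algebra_simps)
    qed
    then show "laplace_class (\<lambda>s. (1 + - (d * (1 - h s)) / real (n + Suc N)) ^ (n + Suc N))"
      using laplace_class_power[OF laplace_class_convex[OF h laplace_class_1 q]] by (simp only:)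
  next
    fix s :: real
    show "(\<lambda>n. (1 + - (d * (1 - h s)) / real (n + Suc N)) ^ (n + Suc N)) \<longlonglongrightarrow> exp (- (a * (c * (1 - h s))))"
      using LIMSEQ_ignore_initial_segment[OF tendsto_exp_limit_sequentially[of "- (d * (1 - h s))"], of "Suc N"]
      by (simp add: d_def mult.assoc)
  next
    have "((\<lambda>s. exp (- (a * (c * (1 - h s))))) \<longlongrightarrow> exp (- (a * (c * (1 - 1))))) (at_right 0)"
      by (intro tendsto_intros laplace_class_tendsto_1[OF h])
    then show "((\<lambda>s. exp (- (a * (c * (1 - h s))))) \<longlongrightarrow> 1) (at_right 0)" by simp
  qed
qed

text \<open>Running a subordinator with exponent \<open>\<psi>\<close> up to an independent time with distribution \<open>P\<close> gives the
  transform of \<open>P\<close> evaluated at \<open>\<psi>\<close>. Both the stability of exponents under composition and the existence of the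
  iterates of the functional equation rest on this.\<close>

lemma laplace_class_subordination:
  assumes \<psi>: "laplace_exponent \<psi>" and P: "nonneg_distribution P"
  shows "laplace_class (\<lambda>s. laplace_stieltjes P (\<psi> s))"
proof -
  have "laplace_class (\<lambda>s. \<integral>y. exp (- (y * \<psi> s)) \<partial>P)"
    by (rule laplace_class_mixture[OF P])
      (use \<psi> in \<open>auto simp: laplace_exponent_def intro!: continuous_intros\<close>)
  then show ?thesis by (simp add: laplace_stieltjes_def mult.commute)
qed

lemma laplace_exponent_compose:
  assumes \<eta>: "laplace_exponent \<eta>" and \<psi>: "laplace_exponent \<psi>"
  shows "laplace_exponent (\<lambda>s. \<eta> (\<psi> s))"
  unfolding laplace_exponent_def
proof (intro allI impI)
  fix a :: real assume "0 \<le> a"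
  then obtain G where G: "nonneg_distribution G"
    and LG: "\<And>u. 0 \<le> u \<Longrightarrow> laplace_stieltjes G u = exp (- (a * \<eta> u))"
    using \<eta> by (auto simp: laplace_exponent_def laplace_class_def)
  from laplace_class_subordination[OF \<psi> G]
  show "laplace_class (\<lambda>s. exp (- (a * \<eta> (\<psi> s))))"
    by (rule laplace_class_cong) (simp add: LG laplace_exponent_nonneg[OF \<psi>])
qed

section \<open>Moments and the behaviour of the transform at the origin\<close>

text \<open>Fatou's lemma in the form that turns a bound on difference quotients of a transform into a finite moment.\<close>

lemma integrable_Fatou:
  fixes f :: "nat \<Rightarrow> 'b \<Rightarrow> real"
  assumes int: "\<And>n. integrable M (f n)" and g [measurable]: "g \<in> borel_measurable M"
    and nonneg: "\<And>n. AE x in M. 0 \<le> f n x"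
    and lim: "AE x in M. (\<lambda>n. f n x) \<longlonglongrightarrow> g x"
    and bound: "eventually (\<lambda>n. (\<integral>x. f n x \<partial>M) \<le> C) sequentially"
  shows "integrable M g" "(\<integral>x. g x \<partial>M) \<le> C"
proof -
  note [measurable] = borel_measurable_integrable[OF int]
  have "AE x in M. \<forall>n. 0 \<le> f n x" using nonneg by (simp add: AE_all_countable)
  with lim have g0: "AE x in M. 0 \<le> g x"
    by eventually_elim (auto intro: LIMSEQ_le_const)
  obtain N where "(\<integral>x. f N x \<partial>M) \<le> C" using bound by (auto simp: eventually_sequentially)
  moreover have "0 \<le> (\<integral>x. f N x \<partial>M)" using nonneg by (rule integral_nonneg_AE)
  ultimately have C: "0 \<le> C" by simp
  have "(\<integral>\<^sup>+x. ennreal (g x) \<partial>M) = (\<integral>\<^sup>+x. liminf (\<lambda>n. ennreal (f n x)) \<partial>M)"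
  proof (rule nn_integral_cong_AE)
    show "AE x in M. ennreal (g x) = liminf (\<lambda>n. ennreal (f n x))"
      using lim by eventually_elim (auto intro!: lim_imp_Liminf[symmetric] tendsto_intros)
  qed
  also have "\<dots> \<le> liminf (\<lambda>n. \<integral>\<^sup>+x. ennreal (f n x) \<partial>M)"
    by (rule nn_integral_liminf) simp
  also have "\<dots> = liminf (\<lambda>n. ennreal (\<integral>x. f n x \<partial>M))"
    by (simp add: nn_integral_eq_integral int nonneg)
  also have "\<dots> \<le> liminf (\<lambda>n. ennreal C)"
    by (rule Liminf_mono) (use bound in \<open>auto elim: eventually_mono intro: ennreal_leI\<close>)
  also have "\<dots> = ennreal C" by (simp add: Liminf_const)
  finally have *: "(\<integral>\<^sup>+x. ennreal (g x) \<partial>M) \<le> ennreal C" .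
  show "integrable M g"
    by (rule integrableI_nonneg) (use g0 * in \<open>auto simp: less_top[symmetric] top_unique\<close>)
  then show "(\<integral>x. g x \<partial>M) \<le> C"
    using * C by (simp add: nn_integral_eq_integral g0)
qed

text \<open>These bounds say that the first and second difference quotients of \<open>exp (- s * x)\<close> at \<open>s = 0\<close> are nonnegative
  and dominated by their limits \<open>x\<close> and \<open>x\<^sup>2 / 2\<close>. So Fatou's lemma applies without knowing that the moment is finite, and
  dominated convergence applies once it is.\<close>

lemma exp_taylor_bounds:
  fixes u :: real assumes "0 \<le> u"
  shows "0 \<le> 1 - exp (-u)" "1 - exp (-u) \<le> u" "0 \<le> exp (-u) - 1 + u" "exp (-u) - 1 + u \<le> u\<^sup>2 / 2"
proof -
  show "0 \<le> 1 - exp (-u)" using assms by simp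
  show *: "0 \<le> exp (-u) - 1 + u" using exp_ge_add_one_self[of "-u"] by simp
  then show "1 - exp (-u) \<le> u" by simp
  have "0 \<le> 0\<^sup>2 / 2 - (exp (-0) - 1 + 0 :: real)" by simp
  also have "\<dots> \<le> u\<^sup>2 / 2 - (exp (-u) - 1 + u)"
  proof (rule DERIV_nonneg_imp_nondecreasing[OF assms])
    fix x :: real assume "0 \<le> x"
    have "((\<lambda>u. u\<^sup>2 / 2 - (exp (-u) - 1 + u)) has_real_derivative x - (- exp (-x) + 1)) (at x)"
      by (auto intro!: derivative_eq_intros)
    moreover have "0 \<le> x - (- exp (-x) + 1)" using exp_ge_add_one_self[of "-x"] by simp
    ultimately show "\<exists>y. ((\<lambda>u. u\<^sup>2 / 2 - (exp (-u) - 1 + u)) has_real_derivative y) (at x) \<and> 0 \<le> y"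
      by blast
  qed
  finally show "exp (-u) - 1 + u \<le> u\<^sup>2 / 2" by simp
qed

lemma filterlim_at_right_0I:
  fixes S :: "nat \<Rightarrow> real"
  assumes "\<And>n. 0 < S n" "S \<longlonglongrightarrow> 0"
  shows "filterlim S (at_right 0) sequentially"
  using assms by (auto simp: filterlim_at less_imp_neq[THEN not_sym])

lemma exp_taylor_LIMSEQ:
  fixes S :: "nat \<Rightarrow> real"
  assumes S: "\<And>n. 0 < S n" "S \<longlonglongrightarrow> 0" and "0 \<le> x"
  shows "(\<lambda>n. (1 - exp (- (S n * x))) / S n) \<longlonglongrightarrow> x"
    "(\<lambda>n. (exp (- (S n * x)) - 1 + S n * x) / (S n)\<^sup>2) \<longlonglongrightarrow> x\<^sup>2 / 2"
proof -
  have F: "filterlim S (at_right 0) sequentially" using S by (rule filterlim_at_right_0I)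
  have "((\<lambda>s. (1 - exp (- (s * x))) / s) \<longlongrightarrow> x) (at_right 0)"
  proof (cases "x = 0")
    case False
    then have "0 < x" using \<open>0 \<le> x\<close> by simp
    then show ?thesis by real_asymp
  qed simp
  from filterlim_compose[OF this F] show "(\<lambda>n. (1 - exp (- (S n * x))) / S n) \<longlonglongrightarrow> x" .
  have "((\<lambda>s. (exp (- (s * x)) - 1 + s * x) / s\<^sup>2) \<longlongrightarrow> x\<^sup>2 / 2) (at_right 0)"
  proof (cases "x = 0")
    case False
    then have "0 < x" using \<open>0 \<le> x\<close> by simp
    then have "((\<lambda>s. (exp (- (s * x)) - 1 + s * x) / s\<^sup>2) \<longlongrightarrow> x * x / 2) (at_right 0)"
      by real_asymp
    then show ?thesis by (simp add: power2_eq_square)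
  qed simp
  from filterlim_compose[OF this F]
  show "(\<lambda>n. (exp (- (S n * x)) - 1 + S n * x) / (S n)\<^sup>2) \<longlonglongrightarrow> x\<^sup>2 / 2" .
qed

context
  fixes F :: "real measure"
  assumes F: "nonneg_distribution F"
begin

interpretation real_distribution F using F by (rule nonneg_distributionD)

lemma laplace_first_difference:
  assumes "0 \<le> s"
  shows "integrable F (\<lambda>x. (1 - exp (- (s * x))) / s)"
    "(\<integral>x. (1 - exp (- (s * x))) / s \<partial>F) = (1 - laplace_stieltjes F s) / s"
  using integrable_laplace[OF F assms] nonneg_distributionD(6)[OF F]
  by (auto simp: laplace_stieltjes_def)

lemma one_minus_laplace_le_mean:
  assumes "integrable F (\<lambda>x. x)" "0 \<le> s"
  shows "1 - laplace_stieltjes F s \<le> s * (\<integral>x. x \<partial>F)"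
proof -
  have "1 - laplace_stieltjes F s = (\<integral>x. 1 - exp (- (s * x)) \<partial>F)"
    using integrable_laplace[OF F assms(2)] nonneg_distributionD(6)[OF F]
    by (simp add: laplace_stieltjes_def)
  also have "\<dots> \<le> (\<integral>x. s * x \<partial>F)"
  proof (rule integral_mono_AE)
    show "AE x in F. 1 - exp (- (s * x)) \<le> s * x"
      using nonneg_distributionD(4)[OF F]
      by eventually_elim (use exp_taylor_bounds(2) assms(2) in auto)
  qed (use assms integrable_laplace[OF F assms(2)] in auto)
  finally show ?thesis by simp
qed

lemma integrable_from_laplace:
  assumes S: "\<And>n. 0 < S n" "S \<longlonglongrightarrow> 0"
    and "eventually (\<lambda>n. (1 - laplace_stieltjes F (S n)) / S n \<le> C) sequentially"
  shows "integrable F (\<lambda>x. x)"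
proof (rule integrable_Fatou(1))
  have S0: "0 \<le> S n" for n using S(1)[of n] by simp
  show "integrable F (\<lambda>x. (1 - exp (- (S n * x))) / S n)" for n
    by (rule laplace_first_difference[OF S0])
  show "eventually (\<lambda>n. (\<integral>x. (1 - exp (- (S n * x))) / S n \<partial>F) \<le> C) sequentially"
    using assms(3) unfolding laplace_first_difference[OF S0] .
  show "AE x in F. 0 \<le> (1 - exp (- (S n * x))) / S n" for n
    using nonneg_distributionD(4)[OF F] by eventually_elim (use S0[of n] in auto)
  show "AE x in F. (\<lambda>n. (1 - exp (- (S n * x))) / S n) \<longlonglongrightarrow> x"
    using nonneg_distributionD(4)[OF F] by eventually_elim (rule exp_taylor_LIMSEQ[OF S])
qed simp

lemma laplace_first_derivative:
  assumes S: "\<And>n. 0 < S n" "S \<longlonglongrightarrow> 0" and int: "integrable F (\<lambda>x. x)"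
  shows "(\<lambda>n. (1 - laplace_stieltjes F (S n)) / S n) \<longlonglongrightarrow> (\<integral>x. x \<partial>F)"
proof -
  have S0: "0 \<le> S n" for n using S(1)[of n] by simp
  have "(\<lambda>n. \<integral>x. (1 - exp (- (S n * x))) / S n \<partial>F) \<longlonglongrightarrow> (\<integral>x. x \<partial>F)"
  proof (rule integral_dominated_convergence[where w="\<lambda>x. x"])
    show "AE x in F. (\<lambda>n. (1 - exp (- (S n * x))) / S n) \<longlonglongrightarrow> x"
      using nonneg_distributionD(4)[OF F] by eventually_elim (rule exp_taylor_LIMSEQ[OF S])
    show "AE x in F. norm ((1 - exp (- (S n * x))) / S n) \<le> x" for n
      using nonneg_distributionD(4)[OF F]
    proof eventually_elim
      case (elim x)
      then show ?case using exp_taylor_bounds(1,2)[of "S n * x"] S(1)[of n]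
        by (simp add: field_simps)
    qed
  qed (simp_all add: int)
  then show ?thesis unfolding laplace_first_difference[OF S0] .
qed

lemma laplace_second_difference:
  assumes int: "integrable F (\<lambda>x. x)" and "0 \<le> s"
  shows "integrable F (\<lambda>x. (exp (- (s * x)) - 1 + s * x) / s\<^sup>2)"
    "(\<integral>x. (exp (- (s * x)) - 1 + s * x) / s\<^sup>2 \<partial>F) = (laplace_stieltjes F s - 1 + (\<integral>x. x \<partial>F) * s) / s\<^sup>2"
  using integrable_laplace[OF F assms(2)] nonneg_distributionD(6)[OF F] int
  by (auto simp: laplace_stieltjes_def mult.commute)

lemma square_integrable_from_laplace:
  assumes int: "integrable F (\<lambda>x. x)" and S: "\<And>n. 0 < S n" "S \<longlonglongrightarrow> 0"
    and "eventually (\<lambda>n. (laplace_stieltjes F (S n) - 1 + (\<integral>x. x \<partial>F) * S n) / (S n)\<^sup>2 \<le> C) sequentially"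
  shows "integrable F (\<lambda>x. x\<^sup>2)" "(\<integral>x. x\<^sup>2 \<partial>F) \<le> 2 * C"
proof -
  have S0: "0 \<le> S n" for n using S(1)[of n] by simp
  have 1: "integrable F (\<lambda>x. (exp (- (S n * x)) - 1 + S n * x) / (S n)\<^sup>2)" for n
    by (rule laplace_second_difference[OF int S0])
  have 2: "eventually (\<lambda>n. (\<integral>x. (exp (- (S n * x)) - 1 + S n * x) / (S n)\<^sup>2 \<partial>F) \<le> C) sequentially"
    using assms(4) unfolding laplace_second_difference[OF int S0] .
  have 3: "AE x in F. 0 \<le> (exp (- (S n * x)) - 1 + S n * x) / (S n)\<^sup>2" for n
    using nonneg_distributionD(4)[OF F] 
    by eventually_elim (use S0[of n] exp_taylor_bounds(3) in auto)
  have 4: "AE x in F. (\<lambda>n. (exp (- (S n * x)) - 1 + S n * x) / (S n)\<^sup>2) \<longlonglongrightarrow> x\<^sup>2 / 2"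
    using nonneg_distributionD(4)[OF F] by eventually_elim (rule exp_taylor_LIMSEQ[OF S])
  have "integrable F (\<lambda>x. x\<^sup>2 / 2)" by (rule integrable_Fatou(1)[OF 1 _ 3 4 2]) simp
  from integrable_mult_right[OF this, of 2] show "integrable F (\<lambda>x. x\<^sup>2)" by simp
  have "(\<integral>x. x\<^sup>2 / 2 \<partial>F) \<le> C" by (rule integrable_Fatou(2)[OF 1 _ 3 4 2]) simp
  then show "(\<integral>x. x\<^sup>2 \<partial>F) \<le> 2 * C" by simp
qed

lemma laplace_second_order_bounds:
  assumes int: "integrable F (\<lambda>x. x)" "integrable F (\<lambda>x. x\<^sup>2)" and s: "0 \<le> s"
  shows "0 \<le> laplace_stieltjes F s - 1 + (\<integral>x. x \<partial>F) * s"
    "laplace_stieltjes F s - 1 + (\<integral>x. x \<partial>F) * s \<le> (\<integral>x. x\<^sup>2 \<partial>F) / 2 * s\<^sup>2"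
proof -
  have eq: "laplace_stieltjes F s - 1 + (\<integral>x. x \<partial>F) * s = (\<integral>x. exp (- (s * x)) - 1 + s * x \<partial>F)"
    using integrable_laplace[OF F s] nonneg_distributionD(6)[OF F] int
    by (simp add: laplace_stieltjes_def mult.commute)
  show "0 \<le> laplace_stieltjes F s - 1 + (\<integral>x. x \<partial>F) * s"
    using one_minus_laplace_le_mean[OF int(1) s] by (simp add: mult.commute)
  have "(\<integral>x. exp (- (s * x)) - 1 + s * x \<partial>F) \<le> (\<integral>x. s\<^sup>2 / 2 * x\<^sup>2 \<partial>F)"
  proof (rule integral_mono_AE)
    show "AE x in F. exp (- (s * x)) - 1 + s * x \<le> s\<^sup>2 / 2 * x\<^sup>2"
      using nonneg_distributionD(4)[OF F]
    proof eventually_elim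
      case (elim x)
      then show ?case using exp_taylor_bounds(4)[of "s * x"] s by (simp add: power_mult_distrib)
    qed
  qed (use int integrable_laplace[OF F s] in auto)
  then show "laplace_stieltjes F s - 1 + (\<integral>x. x \<partial>F) * s \<le> (\<integral>x. x\<^sup>2 \<partial>F) / 2 * s\<^sup>2"
    unfolding eq by (simp add: mult.commute)
qed

lemma laplace_second_derivative:
  assumes int: "integrable F (\<lambda>x. x)" "integrable F (\<lambda>x. x\<^sup>2)" and S: "\<And>n. 0 < S n" "S \<longlonglongrightarrow> 0"
  shows "(\<lambda>n. (laplace_stieltjes F (S n) - 1 + (\<integral>x. x \<partial>F) * S n) / (S n)\<^sup>2) \<longlonglongrightarrow> (\<integral>x. x\<^sup>2 \<partial>F) / 2"
proof -
  have S0: "0 \<le> S n" for n using S(1)[of n] by simp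
  have "(\<lambda>n. \<integral>x. (exp (- (S n * x)) - 1 + S n * x) / (S n)\<^sup>2 \<partial>F) \<longlonglongrightarrow> (\<integral>x. x\<^sup>2 / 2 \<partial>F)"
  proof (rule integral_dominated_convergence[where w="\<lambda>x. x\<^sup>2 / 2"])
    show "AE x in F. (\<lambda>n. (exp (- (S n * x)) - 1 + S n * x) / (S n)\<^sup>2) \<longlonglongrightarrow> x\<^sup>2 / 2"
      using nonneg_distributionD(4)[OF F] by eventually_elim (rule exp_taylor_LIMSEQ[OF S])
    show "AE x in F. norm ((exp (- (S n * x)) - 1 + S n * x) / (S n)\<^sup>2) \<le> x\<^sup>2 / 2" for n
      using nonneg_distributionD(4)[OF F]
    proof eventually_elim
      case (elim x)
      then show ?case using exp_taylor_bounds(3,4)[of "S n * x"] S(1)[of n]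
        by (simp add: field_simps power_mult_distrib)
    qed
  qed (simp_all add: int)
  then show ?thesis unfolding laplace_second_difference[OF int(1) S0] by simp
qed

end

definition moment_class :: "real \<Rightarrow> real \<Rightarrow> real measure \<Rightarrow> bool" where
  "moment_class \<mu> K F \<longleftrightarrow> nonneg_distribution F \<and> integrable F (\<lambda>x. x) \<and> (\<integral>x. x \<partial>F) = \<mu> \<and>
     integrable F (\<lambda>x. x\<^sup>2) \<and> (\<integral>x. x\<^sup>2 \<partial>F) \<le> K"

lemma moment_classD:
  assumes "moment_class \<mu> K F"
  shows "nonneg_distribution F" "0 \<le> \<mu>" "0 \<le> K"
    "0 \<le> s \<Longrightarrow> 0 \<le> laplace_stieltjes F s - 1 + \<mu> * s"
    "0 \<le> s \<Longrightarrow> laplace_stieltjes F s - 1 + \<mu> * s \<le> K / 2 * s\<^sup>2"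
proof -
  have *: "nonneg_distribution F" "integrable F (\<lambda>x. x)" "(\<integral>x. x \<partial>F) = \<mu>"
     "integrable F (\<lambda>x. x\<^sup>2)" "(\<integral>x. x\<^sup>2 \<partial>F) \<le> K"
    using assms by (auto simp: moment_class_def)
  show "nonneg_distribution F" by fact
  show "0 \<le> \<mu>" using nonneg_distributionD(4)[OF *(1)] *(3) by (auto intro: integral_nonneg_AE)
  have "0 \<le> (\<integral>x. x\<^sup>2 \<partial>F)" by simp
  then show "0 \<le> K" using *(5) by linarith
  show "0 \<le> s \<Longrightarrow> 0 \<le> laplace_stieltjes F s - 1 + \<mu> * s"
    using laplace_second_order_bounds(1)[OF *(1,2,4)] *(3) by simp
  assume "0 \<le> s"
  then have "laplace_stieltjes F s - 1 + \<mu> * s \<le> (\<integral>x. x\<^sup>2 \<partial>F) / 2 * s\<^sup>2"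
    using laplace_second_order_bounds(2)[OF *(1,2,4)] *(3) by simp
  also have "\<dots> \<le> K / 2 * s\<^sup>2" using *(5) by (intro mult_right_mono) auto
  finally show "laplace_stieltjes F s - 1 + \<mu> * s \<le> K / 2 * s\<^sup>2" .
qed

text \<open>Mean and second moment can be read off from a quadratic estimate of the transform. Such an
  estimate is stable under pointwise limits, which makes this class suitable for the iteration.\<close>

lemma moment_classI:
  assumes F: "nonneg_distribution F"
    and lo: "\<And>s. 0 < s \<Longrightarrow> 0 \<le> laplace_stieltjes F s - 1 + \<mu> * s"
    and up: "\<And>s. 0 < s \<Longrightarrow> laplace_stieltjes F s - 1 + \<mu> * s \<le> K / 2 * s\<^sup>2"
  shows "moment_class \<mu> K F"
proof -
  define S where "S n = 1 / real (Suc n)" for n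
  have S: "0 < S n" "S \<longlonglongrightarrow> 0" for n
    using LIMSEQ_inverse_real_of_nat unfolding S_def by (simp_all only: inverse_eq_divide) simp
  have le: "(1 - laplace_stieltjes F (S n)) / S n \<le> \<mu>" for n
    using lo[OF S(1)[of n]] S(1)[of n] by (simp add: field_simps)
  have int: "integrable F (\<lambda>x. x)"
    by (rule integrable_from_laplace[OF F S, of \<mu>]) (use le in auto)
  have "(\<lambda>n. (1 - laplace_stieltjes F (S n)) / S n) \<longlonglongrightarrow> \<mu>"
  proof (rule real_tendsto_sandwich)
    show "eventually (\<lambda>n. \<mu> - K / 2 * S n \<le> (1 - laplace_stieltjes F (S n)) / S n) sequentially"
    proof (intro always_eventually allI)
      fix n
      have "(\<mu> - K / 2 * S n) * S n \<le> 1 - laplace_stieltjes F (S n)"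
        using up[OF S(1)[of n]] by (simp add: algebra_simps power2_eq_square)
      then show "\<mu> - K / 2 * S n \<le> (1 - laplace_stieltjes F (S n)) / S n"
        using S(1)[of n] by (simp only: pos_le_divide_eq)
    qed
    have "(\<lambda>n. \<mu> - K / 2 * S n) \<longlonglongrightarrow> \<mu> - K / 2 * 0" by (intro tendsto_intros S)
    then show "(\<lambda>n. \<mu> - K / 2 * S n) \<longlonglongrightarrow> \<mu>" by simp
  qed (use le in auto)
  with laplace_first_derivative[OF F S int] have \<mu>: "(\<integral>x. x \<partial>F) = \<mu>"
    by (rule LIMSEQ_unique)
  have "eventually (\<lambda>n. (laplace_stieltjes F (S n) - 1 + (\<integral>x. x \<partial>F) * S n) / (S n)\<^sup>2 \<le> K / 2) sequentially"
  proof (intro always_eventually allI)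
    fix n
    have "0 < (S n)\<^sup>2" using S(1)[of n] by simp
    then show "(laplace_stieltjes F (S n) - 1 + (\<integral>x. x \<partial>F) * S n) / (S n)\<^sup>2 \<le> K / 2"
      unfolding \<mu> using up[OF S(1)[of n]] by (simp only: pos_divide_le_eq)
  qed
  from square_integrable_from_laplace[OF F int S this] show ?thesis
    using F int \<mu> by (simp add: moment_class_def)
qed

section \<open>The function sigma\<close>

definition sigma_integrand :: "real measure \<Rightarrow> real \<Rightarrow> real \<Rightarrow> real \<Rightarrow> real" where
  "sigma_integrand F \<mu> s t = (if t = 0 then \<mu> * s else (1 - laplace_stieltjes F (t * s)) / t)"

lemma sigma_fun_altdef: "sigma_fun P \<mu> F s = (\<integral>t. sigma_integrand F \<mu> s t \<partial>P)"
  by (simp add: sigma_fun_def sigma_integrand_def)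

lemma measurable_sigma_integrand [measurable]:
  assumes "nonneg_distribution F"
  shows "sigma_integrand F \<mu> s \<in> borel_measurable borel"
proof -
  note [measurable] = measurable_laplace[OF assms]
  show ?thesis unfolding sigma_integrand_def by measurable
qed

context
  fixes F :: "real measure" and \<mu> K :: real
  assumes F: "moment_class \<mu> K F"
begin

lemma sigma_integrand_bounds:
  assumes "0 \<le> s" "0 \<le> t"
  shows "0 \<le> sigma_integrand F \<mu> s t" "sigma_integrand F \<mu> s t \<le> \<mu> * s"
    "\<mu> * s - sigma_integrand F \<mu> s t \<le> K / 2 * s\<^sup>2 * t"
proof -
  note FD = moment_classD[OF F]
  show "0 \<le> sigma_integrand F \<mu> s t"
    using assms FD(2) laplace_le_1[OF FD(1), of "t * s"] by (simp add: sigma_integrand_def)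
  show "sigma_integrand F \<mu> s t \<le> \<mu> * s"
  proof (cases "t = 0")
    case False
    then have "0 < t" using assms by simp
    have "1 - laplace_stieltjes F (t * s) \<le> \<mu> * s * t"
      using FD(4)[of "t * s"] assms by (simp add: mult_ac)
    then show ?thesis using \<open>0 < t\<close> by (simp add: sigma_integrand_def pos_divide_le_eq)
  qed (simp add: sigma_integrand_def)
  show "\<mu> * s - sigma_integrand F \<mu> s t \<le> K / 2 * s\<^sup>2 * t"
  proof (cases "t = 0")
    case False
    then have "0 < t" using assms by simp
    have "(\<mu> * s - K / 2 * s\<^sup>2 * t) * t \<le> 1 - laplace_stieltjes F (t * s)"
      using FD(5)[of "t * s"] assms by (simp add: algebra_simps power2_eq_square)
    then have "\<mu> * s - K / 2 * s\<^sup>2 * t \<le> (1 - laplace_stieltjes F (t * s)) / t"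
      using \<open>0 < t\<close> by (simp only: pos_le_divide_eq)
    moreover have "sigma_integrand F \<mu> s t = (1 - laplace_stieltjes F (t * s)) / t"
      using \<open>0 < t\<close> by (simp add: sigma_integrand_def)
    ultimately show ?thesis by linarith
  qed (simp add: sigma_integrand_def)
qed

text \<open>Adding \<open>1 / (n + 1)\<close> to \<open>t\<close> avoids the special value of the integrand at \<open>t = 0\<close>; this is right-continuity
  in \<open>t\<close>, and at \<open>t = 0\<close> it expresses that \<open>\<mu>\<close> is the derivative at 0 of one minus the transform.\<close>

lemma sigma_integrand_shift_LIMSEQ:
  assumes "0 \<le> s" "0 \<le> t"
  shows "(\<lambda>n. sigma_integrand F \<mu> s (t + 1 / real (Suc n))) \<longlonglongrightarrow> sigma_integrand F \<mu> s t"
proof -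
  have e: "(\<lambda>n. 1 / real (Suc n)) \<longlonglongrightarrow> 0"
    using LIMSEQ_inverse_real_of_nat by (simp only: inverse_eq_divide)
  show ?thesis
  proof (cases "t = 0")
    case True
    have "(\<lambda>n. sigma_integrand F \<mu> s (1 / real (Suc n))) \<longlonglongrightarrow> \<mu> * s"
    proof (rule real_tendsto_sandwich)
      have "(\<lambda>n. \<mu> * s - K / 2 * s\<^sup>2 * (1 / real (Suc n))) \<longlonglongrightarrow> \<mu> * s - K / 2 * s\<^sup>2 * 0"
        by (intro tendsto_intros e)
      then show "(\<lambda>n. \<mu> * s - K / 2 * s\<^sup>2 * (1 / real (Suc n))) \<longlonglongrightarrow> \<mu> * s" by simp
      show "eventually (\<lambda>n. \<mu> * s - K / 2 * s\<^sup>2 * (1 / real (Suc n)) \<le> sigma_integrand F \<mu> s (1 / real (Suc n))) sequentially"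
        using sigma_integrand_bounds(3)[OF assms(1), of "1 / real (Suc n)" for n]
        by (auto intro!: always_eventually simp: algebra_simps)
      show "eventually (\<lambda>n. sigma_integrand F \<mu> s (1 / real (Suc n)) \<le> \<mu> * s) sequentially"
        using sigma_integrand_bounds(2)[OF assms(1), of "1 / real (Suc n)" for n]
        by (auto intro!: always_eventually)
    qed simp
    then show ?thesis using True by (simp add: sigma_integrand_def)
  next
    case False
    then have "0 < t" using assms by simp
    then have nz: "t + 1 / real (Suc n) \<noteq> 0" for n
      by (smt (verit) of_nat_0_le_iff zero_le_divide_1_iff)
    have lim: "(\<lambda>n. t + 1 / real (Suc n)) \<longlonglongrightarrow> t"
      using tendsto_add[OF tendsto_const e, of t] by (simp only: add_0_right)
    have "(\<lambda>n. (t + 1 / real (Suc n)) * s) \<longlonglongrightarrow> t * s" by (intro tendsto_intros lim)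
    then have "(\<lambda>n. laplace_stieltjes F ((t + 1 / real (Suc n)) * s)) \<longlonglongrightarrow> laplace_stieltjes F (t * s)"
      by (rule laplace_LIMSEQ[OF moment_classD(1)[OF F], rotated 2]) (use assms in auto)
    then have "(\<lambda>n. (1 - laplace_stieltjes F ((t + 1 / real (Suc n)) * s)) / (t + 1 / real (Suc n)))
        \<longlonglongrightarrow> (1 - laplace_stieltjes F (t * s)) / t"
      by (intro tendsto_intros lim) (use False in auto)
    then show ?thesis using nz False by (simp only: sigma_integrand_def if_False)
  qed
qed

text \<open>For \<open>t > 0\<close> the quotient is \<open>t\<close> times the second difference quotient of the transform at \<open>t * S n\<close>, hence the
  second moment of \<open>F\<close> enters multiplied by \<open>t\<close>.\<close>

lemma sigma_integrand_second_difference_LIMSEQ: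
  assumes S: "\<And>n. 0 < S n" "S \<longlonglongrightarrow> 0" and "0 \<le> t"
  shows "(\<lambda>n. (\<mu> * S n - sigma_integrand F \<mu> (S n) t) / (S n)\<^sup>2) \<longlonglongrightarrow> (\<integral>x. x\<^sup>2 \<partial>F) / 2 * t"
proof (cases "t = 0")
  case False
  then have t: "0 < t" using assms by simp
  have F': "nonneg_distribution F" "integrable F (\<lambda>x. x)" "(\<integral>x. x \<partial>F) = \<mu>" "integrable F (\<lambda>x. x\<^sup>2)"
    using F by (auto simp: moment_class_def)
  have "(\<lambda>n. t * S n) \<longlonglongrightarrow> t * 0" by (intro tendsto_intros S)
  then have "(\<lambda>n. (laplace_stieltjes F (t * S n) - 1 + \<mu> * (t * S n)) / (t * S n)\<^sup>2) \<longlonglongrightarrow> (\<integral>x. x\<^sup>2 \<partial>F) / 2"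
    using laplace_second_derivative[OF F'(1,2,4), of "\<lambda>n. t * S n"] S t F'(3) by simp
  then have "(\<lambda>n. (laplace_stieltjes F (t * S n) - 1 + \<mu> * (t * S n)) / (t * S n)\<^sup>2 * t) \<longlonglongrightarrow> (\<integral>x. x\<^sup>2 \<partial>F) / 2 * t"
    by (rule tendsto_mult_right)
  moreover have "(laplace_stieltjes F (t * S n) - 1 + \<mu> * (t * S n)) / (t * S n)\<^sup>2 * t
      = (\<mu> * S n - sigma_integrand F \<mu> (S n) t) / (S n)\<^sup>2" for n
    using t S(1)[of n] by (simp add: sigma_integrand_def power2_eq_square field_simps)
  ultimately show ?thesis by simp
qed (simp add: sigma_integrand_def)

context
  fixes P :: "real measure"
  assumes P: "nonneg_distribution P"
begin

interpretation real_distribution P using P by (rule nonneg_distributionD)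

lemma integrable_sigma_integrand:
  assumes "0 \<le> s"
  shows "integrable P (sigma_integrand F \<mu> s)"
proof (rule integrable_const_bound[of _ "\<mu> * s"])
  show "AE t in P. norm (sigma_integrand F \<mu> s t) \<le> \<mu> * s"
    using nonneg_distributionD(4)[OF P]
    by eventually_elim (use sigma_integrand_bounds(1,2)[OF assms] in auto)
qed (use measurable_sigma_integrand[OF moment_classD(1)[OF F]] in simp)

lemma sigma_fun_nonneg: "0 \<le> s \<Longrightarrow> 0 \<le> sigma_fun P \<mu> F s"
  unfolding sigma_fun_altdef using nonneg_distributionD(4)[OF P]
  by (intro integral_nonneg_AE) (auto elim!: eventually_mono intro: sigma_integrand_bounds)

lemma sigma_fun_difference:
  assumes "0 \<le> s"
  shows "integrable P (\<lambda>t. (\<mu> * s - sigma_integrand F \<mu> s t) / c)"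
    "(\<integral>t. (\<mu> * s - sigma_integrand F \<mu> s t) / c \<partial>P) = (\<mu> * s - sigma_fun P \<mu> F s) / c"
  using integrable_sigma_integrand[OF assms] nonneg_distributionD(6)[OF P]
  by (auto simp: sigma_fun_altdef)

lemma sigma_fun_le:
  assumes "0 \<le> s"
  shows "sigma_fun P \<mu> F s \<le> \<mu> * s"
proof -
  have "sigma_fun P \<mu> F s \<le> (\<integral>t. \<mu> * s \<partial>P)"
    unfolding sigma_fun_altdef
  proof (rule integral_mono_AE)
    show "AE t in P. sigma_integrand F \<mu> s t \<le> \<mu> * s"
      using nonneg_distributionD(4)[OF P]
      by eventually_elim (use sigma_integrand_bounds(2)[OF assms] in auto)
  qed (use integrable_sigma_integrand[OF assms] in auto)
  then show ?thesis using nonneg_distributionD(6)[OF P] by simp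
qed

lemma sigma_fun_second_order_bound:
  assumes "0 \<le> s" and int: "integrable P (\<lambda>t. t)"
  shows "\<mu> * s - sigma_fun P \<mu> F s \<le> (\<integral>t. t \<partial>P) * K / 2 * s\<^sup>2"
proof -
  have "(\<integral>t. (\<mu> * s - sigma_integrand F \<mu> s t) / 1 \<partial>P) \<le> (\<integral>t. K / 2 * s\<^sup>2 * t \<partial>P)"
  proof (rule integral_mono_AE)
    show "AE t in P. (\<mu> * s - sigma_integrand F \<mu> s t) / 1 \<le> K / 2 * s\<^sup>2 * t"
      using nonneg_distributionD(4)[OF P]
      by eventually_elim (use sigma_integrand_bounds(3)[OF assms(1)] in auto)
  qed (use sigma_fun_difference(1)[OF assms(1), of 1] int in auto)
  then show ?thesis
    unfolding sigma_fun_difference(2)[OF assms(1)] by (simp add: mult_ac)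
qed

text \<open>The positive mean guarantees a positive second moment of \<open>F\<close>, so that the limit of the integrands is a
  positive multiple of \<open>t\<close>.\<close>

lemma integrable_from_sigma_fun:
  assumes S: "\<And>n. 0 < S n" "S \<longlonglongrightarrow> 0" and "0 < \<mu>"
    and "eventually (\<lambda>n. (\<mu> * S n - sigma_fun P \<mu> F (S n)) / (S n)\<^sup>2 \<le> C) sequentially"
  shows "integrable P (\<lambda>t. t)"
proof -
  have S0: "0 \<le> S n" for n using S(1)[of n] by simp
  have F': "nonneg_distribution F" "(\<integral>x. x \<partial>F) = \<mu>" "integrable F (\<lambda>x. x\<^sup>2)"
    using F by (auto simp: moment_class_def)
  (* A vanishing second moment would concentrate F at 0 and contradict the positive mean. *)
  have "(\<integral>x. x\<^sup>2 \<partial>F) \<noteq> 0"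
  proof
    assume "(\<integral>x. x\<^sup>2 \<partial>F) = 0"
    then have "AE x in F. x\<^sup>2 = 0"
      using F'(3) by (subst (asm) integral_nonneg_eq_0_iff_AE) auto
    then have "(\<integral>x. x \<partial>F) = 0" by (intro integral_eq_zero_AE) auto
    then show False using \<open>0 < \<mu>\<close> F'(2) by simp
  qed
  have "integrable P (\<lambda>t. (\<integral>x. x\<^sup>2 \<partial>F) / 2 * t)"
  proof (rule integrable_Fatou(1)[where f="\<lambda>n t. (\<mu> * S n - sigma_integrand F \<mu> (S n) t) / (S n)\<^sup>2"])
    show "integrable P (\<lambda>t. (\<mu> * S n - sigma_integrand F \<mu> (S n) t) / (S n)\<^sup>2)" for n
      by (rule sigma_fun_difference[OF S0])
    show "eventually (\<lambda>n. (\<integral>t. (\<mu> * S n - sigma_integrand F \<mu> (S n) t) / (S n)\<^sup>2 \<partial>P) \<le> C) sequentially"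
      unfolding sigma_fun_difference[OF S0] by fact
    show "AE t in P. 0 \<le> (\<mu> * S n - sigma_integrand F \<mu> (S n) t) / (S n)\<^sup>2" for n
      using nonneg_distributionD(4)[OF P]
      by eventually_elim (use sigma_integrand_bounds(2)[OF S0] in auto)
    show "AE t in P. (\<lambda>n. (\<mu> * S n - sigma_integrand F \<mu> (S n) t) / (S n)\<^sup>2) \<longlonglongrightarrow> (\<integral>x. x\<^sup>2 \<partial>F) / 2 * t"
      using nonneg_distributionD(4)[OF P]
      by eventually_elim (rule sigma_integrand_second_difference_LIMSEQ[OF S])
  qed simp
  from integrable_mult_right[OF this, of "2 / (\<integral>x. x\<^sup>2 \<partial>F)"]
  show ?thesis using \<open>(\<integral>x. x\<^sup>2 \<partial>F) \<noteq> 0\<close> by simp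
qed

lemma sigma_fun_second_derivative:
  assumes S: "\<And>n. 0 < S n" "S \<longlonglongrightarrow> 0" and int: "integrable P (\<lambda>t. t)"
  shows "(\<lambda>n. (\<mu> * S n - sigma_fun P \<mu> F (S n)) / (S n)\<^sup>2) \<longlonglongrightarrow> (\<integral>t. t \<partial>P) * (\<integral>x. x\<^sup>2 \<partial>F) / 2"
proof -
  have S0: "0 \<le> S n" for n using S(1)[of n] by simp
  have "(\<lambda>n. \<integral>t. (\<mu> * S n - sigma_integrand F \<mu> (S n) t) / (S n)\<^sup>2 \<partial>P) \<longlonglongrightarrow> (\<integral>t. (\<integral>x. x\<^sup>2 \<partial>F) / 2 * t \<partial>P)"
  proof (rule integral_dominated_convergence[where w="\<lambda>t. K / 2 * t"])
    show "(\<lambda>t. (\<mu> * S n - sigma_integrand F \<mu> (S n) t) / (S n)\<^sup>2) \<in> borel_measurable P" for n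
      using sigma_fun_difference(1)[OF S0, of n "(S n)\<^sup>2"] by (rule borel_measurable_integrable)
    show "AE t in P. (\<lambda>n. (\<mu> * S n - sigma_integrand F \<mu> (S n) t) / (S n)\<^sup>2) \<longlonglongrightarrow> (\<integral>x. x\<^sup>2 \<partial>F) / 2 * t"
      using nonneg_distributionD(4)[OF P]
      by eventually_elim (rule sigma_integrand_second_difference_LIMSEQ[OF S])
    show "AE t in P. norm ((\<mu> * S n - sigma_integrand F \<mu> (S n) t) / (S n)\<^sup>2) \<le> K / 2 * t" for n
      using nonneg_distributionD(4)[OF P]
    proof eventually_elim
      case (elim t)
      have "0 \<le> (\<mu> * S n - sigma_integrand F \<mu> (S n) t) / (S n)\<^sup>2"
        using sigma_integrand_bounds(2)[OF S0 elim, of n] by simp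
      moreover have "(\<mu> * S n - sigma_integrand F \<mu> (S n) t) / (S n)\<^sup>2 \<le> K / 2 * t"
        using sigma_integrand_bounds(3)[OF S0 elim, of n] S(1)[of n]
        by (subst pos_divide_le_eq) (auto simp: mult_ac)
      ultimately show ?case by (simp only: real_norm_def abs_of_nonneg)
    qed
  qed (simp_all add: int)
  then show ?thesis unfolding sigma_fun_difference[OF S0] by (simp add: mult_ac)
qed

lemma sigma_fun_first_derivative:
  assumes S: "\<And>n. 0 < S n" "S \<longlonglongrightarrow> 0"
  shows "(\<lambda>n. sigma_fun P \<mu> F (S n) / S n) \<longlonglongrightarrow> \<mu>"
proof -
  have S0: "0 \<le> S n" for n using S(1)[of n] by simp
  have "(\<lambda>n. \<integral>t. sigma_integrand F \<mu> (S n) t / S n \<partial>P) \<longlonglongrightarrow> (\<integral>t. \<mu> \<partial>P)"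
  proof (rule integral_dominated_convergence[where w="\<lambda>t. \<mu>"])
    show "(\<lambda>t. sigma_integrand F \<mu> (S n) t / S n) \<in> borel_measurable P" for n
      using measurable_sigma_integrand[OF moment_classD(1)[OF F], of \<mu> "S n"] by simp
    show "AE t in P. (\<lambda>n. sigma_integrand F \<mu> (S n) t / S n) \<longlonglongrightarrow> \<mu>"
      using nonneg_distributionD(4)[OF P]
    proof eventually_elim
      case (elim t)
      show ?case
      proof (rule real_tendsto_sandwich)
        have "(\<lambda>n. \<mu> - K / 2 * t * S n) \<longlonglongrightarrow> \<mu> - K / 2 * t * 0" by (intro tendsto_intros S)
        then show "(\<lambda>n. \<mu> - K / 2 * t * S n) \<longlonglongrightarrow> \<mu>" by simp
        show "eventually (\<lambda>n. \<mu> - K / 2 * t * S n \<le> sigma_integrand F \<mu> (S n) t / S n) sequentially"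
        proof (intro always_eventually allI)
          fix n
          have "(\<mu> - K / 2 * t * S n) * S n \<le> sigma_integrand F \<mu> (S n) t"
            using sigma_integrand_bounds(3)[OF S0 elim, of n] by (simp add: algebra_simps power2_eq_square)
          then show "\<mu> - K / 2 * t * S n \<le> sigma_integrand F \<mu> (S n) t / S n"
            using S(1)[of n] by (simp only: pos_le_divide_eq)
        qed
        show "eventually (\<lambda>n. sigma_integrand F \<mu> (S n) t / S n \<le> \<mu>) sequentially"
          using sigma_integrand_bounds(2)[OF S0 elim] S(1)
          by (auto intro!: always_eventually simp: pos_divide_le_eq)
      qed simp
    qed
    show "AE t in P. norm (sigma_integrand F \<mu> (S n) t / S n) \<le> \<mu>" for n
      using nonneg_distributionD(4)[OF P]
    proof eventually_elim
      case (elim t)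
      then show ?case using sigma_integrand_bounds(1,2)[OF S0 elim, of n] S(1)[of n]
        by (simp add: pos_divide_le_eq)
    qed
  qed simp_all
  then show ?thesis
    using nonneg_distributionD(6)[OF P] by (simp add: sigma_fun_altdef)
qed

text \<open>Replacing \<open>t\<close> by \<open>t + e\<close> makes the weight \<open>1 / (t + e)\<close> bounded by \<open>1 / e\<close>, so the integral becomes the compound
  Poisson exponent \<open>(1 / e) * (1 - h)\<close>, where \<open>h\<close> mixes scaled copies of \<open>F\<close> with a unit mass at 0. The drift
  contributed by an atom of \<open>P\<close> at 0 appears in the limit \<open>e \<rightarrow> 0\<close>.\<close>

lemma laplace_exponent_sigma_fun: "laplace_exponent (sigma_fun P \<mu> F)"
proof (rule laplace_exponent_limit)
  fix n
  define e where "e = 1 / real (Suc n)"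
  have e: "0 < e" by (simp add: e_def)
  note F' = moment_classD(1)[OF F]
  have LF: "laplace_class (laplace_stieltjes F)" using F' by (auto simp: laplace_class_def)
  define h where "h s = (\<integral>t. e / (t + e) * laplace_stieltjes F ((t + e) * s) + (1 - e / (t + e)) * 1 \<partial>P)" for s
  have h: "laplace_class h"
    unfolding h_def
  proof (rule laplace_class_mixture[OF P])
    fix t :: real assume t: "0 \<le> t"
    show "laplace_class (\<lambda>s. e / (t + e) * laplace_stieltjes F ((t + e) * s) + (1 - e / (t + e)) * 1)"
      using t e by (intro laplace_class_convex laplace_class_scale[OF LF] laplace_class_1)
        (auto simp: field_simps)
  next
    fix s :: real assume s: "0 \<le> s"
    show "continuous_on {0..} (\<lambda>t. e / (t + e) * laplace_stieltjes F ((t + e) * s) + (1 - e / (t + e)) * 1)"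
      by (intro continuous_intros continuous_on_compose2[OF continuous_on_laplace[OF F']]) (use s e in auto)
    note [measurable] = measurable_laplace[OF F']
    show "(\<lambda>t. e / (t + e) * laplace_stieltjes F ((t + e) * s) + (1 - e / (t + e)) * 1) \<in> borel_measurable borel"
      by measurable
  qed
  have eq: "(1 / e) * (1 - h s) = (\<integral>t. sigma_integrand F \<mu> s (t + 1 / real (Suc n)) \<partial>P)" if s: "0 \<le> s" for s
  proof -
    have "(\<integral>t. sigma_integrand F \<mu> s (t + e) \<partial>P)
       = (\<integral>t. (1 / e) * (1 - (e / (t + e) * laplace_stieltjes F ((t + e) * s) + (1 - e / (t + e)) * 1)) \<partial>P)"
    proof (rule integral_cong_AE)
      show "AE t in P. sigma_integrand F \<mu> s (t + e)
         = (1 / e) * (1 - (e / (t + e) * laplace_stieltjes F ((t + e) * s) + (1 - e / (t + e)) * 1))"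
        using nonneg_distributionD(4)[OF P]
      proof eventually_elim
        case (elim t)
        then have "t + e \<noteq> 0" using e by simp
        have "1 - (q * L + (1 - q) * 1) = q * (1 - L)" for q L :: real
          by (simp add: algebra_simps)
        then have "(1 / e) * (1 - (q * L + (1 - q) * 1)) = (1 / e * q) * (1 - L)" for q L :: real
          by (simp only: mult.assoc)
        moreover have "1 / e * (e / (t + e)) = 1 / (t + e)" using e by simp
        ultimately show ?case using \<open>t + e \<noteq> 0\<close>
          by (simp only: sigma_integrand_def if_False) simp
      qed
      note [measurable] = measurable_laplace[OF F'] measurable_sigma_integrand[OF F', of \<mu> s]
      show "(\<lambda>t. sigma_integrand F \<mu> s (t + e)) \<in> borel_measurable P" by measurable
      show "(\<lambda>t. (1 / e) * (1 - (e / (t + e) * laplace_stieltjes F ((t + e) * s) + (1 - e / (t + e)) * 1))) \<in> borel_measurable P"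
        by measurable
    qed
    also have "\<dots> = (1 / e) * (1 - h s)"
    proof -
      have "integrable P (\<lambda>t. e / (t + e) * laplace_stieltjes F ((t + e) * s) + (1 - e / (t + e)) * 1)"
      proof (rule integrable_const_bound[of _ 1])
        show "AE t in P. norm (e / (t + e) * laplace_stieltjes F ((t + e) * s) + (1 - e / (t + e)) * 1) \<le> 1"
          using nonneg_distributionD(4)[OF P]
        proof eventually_elim
          case (elim t)
          then have "laplace_class (\<lambda>s. e / (t + e) * laplace_stieltjes F ((t + e) * s) + (1 - e / (t + e)) * 1)"
            using e by (intro laplace_class_convex laplace_class_scale[OF LF] laplace_class_1)
              (auto simp: field_simps)
          from laplace_classD(2,3)[OF this s] show ?case by simp
        qed
        note [measurable] = measurable_laplace[OF F']
        show "(\<lambda>t. e / (t + e) * laplace_stieltjes F ((t + e) * s) + (1 - e / (t + e)) * 1) \<in> borel_measurable P"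
          by measurable
      qed
      then show ?thesis using nonneg_distributionD(6)[OF P] unfolding h_def
        by (subst integral_mult_right_zero, subst Bochner_Integration.integral_diff) auto
    qed
    finally show ?thesis by (simp add: e_def)
  qed
  have "0 \<le> 1 / e" using e by simp
  from laplace_exponent_cong[OF laplace_exponent_compound_poisson[OF h this] eq]
  show "laplace_exponent (\<lambda>s. \<integral>t. sigma_integrand F \<mu> s (t + 1 / real (Suc n)) \<partial>P)" .
next
  fix s :: real assume s: "0 \<le> s"
  note F' = moment_classD(1)[OF F]
  note [measurable] = measurable_sigma_integrand[OF F', of \<mu> s]
  show "(\<lambda>n. \<integral>t. sigma_integrand F \<mu> s (t + 1 / real (Suc n)) \<partial>P) \<longlonglongrightarrow> sigma_fun P \<mu> F s"
    unfolding sigma_fun_altdef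
  proof (rule integral_dominated_convergence[where w="\<lambda>t. \<mu> * s"])
    show "(\<lambda>t. sigma_integrand F \<mu> s (t + 1 / real (Suc n))) \<in> borel_measurable P" for n by measurable
    show "sigma_integrand F \<mu> s \<in> borel_measurable P" by measurable
    show "AE t in P. (\<lambda>n. sigma_integrand F \<mu> s (t + 1 / real (Suc n))) \<longlonglongrightarrow> sigma_integrand F \<mu> s t"
      using nonneg_distributionD(4)[OF P]
      by eventually_elim (rule sigma_integrand_shift_LIMSEQ[OF s])
    show "AE t in P. norm (sigma_integrand F \<mu> s (t + 1 / real (Suc n))) \<le> \<mu> * s" for n
      using nonneg_distributionD(4)[OF P]
    proof eventually_elim
      case (elim t)
      then have "0 \<le> t + 1 / real (Suc n)" by simp
      from sigma_integrand_bounds(1,2)[OF s this] show ?case by simp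
    qed
  qed simp
next
  show "(sigma_fun P \<mu> F \<longlongrightarrow> 0) (at_right 0)"
  proof (rule real_tendsto_sandwich[where f="\<lambda>_. 0" and h="\<lambda>s. \<mu> * s"])
    have "((\<lambda>s. \<mu> * s) \<longlongrightarrow> \<mu> * 0) (at_right 0)" by (intro tendsto_intros)
    then show "((\<lambda>s. \<mu> * s) \<longlongrightarrow> 0) (at_right 0)" by simp
    show "eventually (\<lambda>s. 0 \<le> sigma_fun P \<mu> F s) (at_right 0)"
      using eventually_at_right_less[of 0] by eventually_elim (simp add: sigma_fun_nonneg)
    show "eventually (\<lambda>s. sigma_fun P \<mu> F s \<le> \<mu> * s) (at_right 0)"
      using eventually_at_right_less[of 0] by eventually_elim (simp add: sigma_fun_le)
  qed simp
qed

end

end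

text \<open>The weight \<open>1 / t\<close> against \<open>(t * s)\<^sup>2\<close> leaves one factor \<open>t\<close>: in the distance
  \<open>sup \<bar>\<dots>\<bar> / s\<^sup>2\<close> the map contracts by the mean of \<open>P\<close>. A first-order distance would give no gain.\<close>

lemma sigma_fun_contraction:
  assumes F: "moment_class \<mu> K F" and G: "moment_class \<mu> K G" and P: "nonneg_distribution P"
    and int: "integrable P (\<lambda>t. t)" and s: "0 \<le> s"
    and D: "\<And>u. 0 \<le> u \<Longrightarrow> \<bar>laplace_stieltjes F u - laplace_stieltjes G u\<bar> \<le> D * u\<^sup>2"
  shows "\<bar>sigma_fun P \<mu> F s - sigma_fun P \<mu> G s\<bar> \<le> (\<integral>t. t \<partial>P) * D * s\<^sup>2"
proof -
  note iF = integrable_sigma_integrand[OF F P s] and iG = integrable_sigma_integrand[OF G P s]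
  have "\<bar>sigma_fun P \<mu> F s - sigma_fun P \<mu> G s\<bar>
      = \<bar>\<integral>t. sigma_integrand F \<mu> s t - sigma_integrand G \<mu> s t \<partial>P\<bar>"
    by (simp add: sigma_fun_altdef iF iG)
  also have "\<dots> \<le> (\<integral>t. \<bar>sigma_integrand F \<mu> s t - sigma_integrand G \<mu> s t\<bar> \<partial>P)"
    by (rule integral_abs_bound)
  also have "\<dots> \<le> (\<integral>t. D * s\<^sup>2 * t \<partial>P)"
  proof (rule integral_mono_AE)
    show "integrable P (\<lambda>t. \<bar>sigma_integrand F \<mu> s t - sigma_integrand G \<mu> s t\<bar>)"
      using iF iG by (intro integrable_abs Bochner_Integration.integrable_diff)
    show "AE t in P. \<bar>sigma_integrand F \<mu> s t - sigma_integrand G \<mu> s t\<bar> \<le> D * s\<^sup>2 * t"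
      using nonneg_distributionD(4)[OF P]
    proof eventually_elim
      case (elim t)
      show ?case
      proof (cases "t = 0")
        case False
        then have t: "0 < t" using elim by simp
        have "sigma_integrand F \<mu> s t - sigma_integrand G \<mu> s t
           = (laplace_stieltjes G (t * s) - laplace_stieltjes F (t * s)) / t"
          using t by (simp add: sigma_integrand_def diff_divide_distrib)
        then have "\<bar>sigma_integrand F \<mu> s t - sigma_integrand G \<mu> s t\<bar>
           = \<bar>laplace_stieltjes F (t * s) - laplace_stieltjes G (t * s)\<bar> / t"
          using t by (simp add: abs_minus_commute)
        also have "\<dots> \<le> D * (t * s)\<^sup>2 / t"
          using t s by (intro divide_right_mono D) auto
        also have "\<dots> = D * s\<^sup>2 * t" using t by (simp add: power2_eq_square)
        finally show ?thesis .
      qed (simp add: sigma_integrand_def)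
    qed
  qed (use int in simp)
  also have "\<dots> = (\<integral>t. t \<partial>P) * D * s\<^sup>2" by (simp add: mult_ac)
  finally show ?thesis .
qed

lemma sigma_fun_LIMSEQ:
  assumes F: "\<And>n. moment_class \<mu> K (F n)" and G: "moment_class \<mu> K G" and P: "nonneg_distribution P"
    and s: "0 \<le> s"
    and lim: "\<And>u. 0 \<le> u \<Longrightarrow> (\<lambda>n. laplace_stieltjes (F n) u) \<longlonglongrightarrow> laplace_stieltjes G u"
  shows "(\<lambda>n. sigma_fun P \<mu> (F n) s) \<longlonglongrightarrow> sigma_fun P \<mu> G s"
  unfolding sigma_fun_altdef
proof (rule integral_dominated_convergence[where w="\<lambda>t. \<mu> * s"])
  interpret real_distribution P using P by (rule nonneg_distributionD)
  show "integrable P (\<lambda>t. \<mu> * s)" by simp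
  show "sigma_integrand G \<mu> s \<in> borel_measurable P"
    using integrable_sigma_integrand[OF G P s] by (rule borel_measurable_integrable)
  show "sigma_integrand (F n) \<mu> s \<in> borel_measurable P" for n
    using integrable_sigma_integrand[OF F P s] by (rule borel_measurable_integrable)
  show "AE t in P. norm (sigma_integrand (F n) \<mu> s t) \<le> \<mu> * s" for n
    using nonneg_distributionD(4)[OF P]
    by eventually_elim (use sigma_integrand_bounds(1,2)[OF F s] in auto)
  show "AE t in P. (\<lambda>n. sigma_integrand (F n) \<mu> s t) \<longlonglongrightarrow> sigma_integrand G \<mu> s t"
    using nonneg_distributionD(4)[OF P]
  proof eventually_elim
    case (elim t)
    show ?case
      using s elim by (cases "t = 0") (auto simp: sigma_integrand_def intro!: tendsto_intros lim)
  qed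
qed

section \<open>The function sigma-B and the logarithm\<close>

lemma moment_class_return:
  assumes c: "0 \<le> c"
  shows "moment_class c (c\<^sup>2) (return borel c)"
proof -
  interpret real_distribution "return borel c"
    by (rule nonneg_distributionD(5)[OF nonneg_distribution_return[OF c]])
  have ae: "AE x in return borel c. x = c" by (subst AE_return) auto
  have "integrable (return borel c) (\<lambda>x. x ^ k)" for k
  proof (rule integrable_const_bound[of _ "\<bar>c ^ k\<bar>"])
    show "AE x in return borel c. norm (x ^ k) \<le> \<bar>c ^ k\<bar>" using ae by eventually_elim simp
  qed measurable
  from this[of 1] this[of 2]
  have "integrable (return borel c) (\<lambda>x. x)" "integrable (return borel c) (\<lambda>x. x\<^sup>2)"
    by (simp_all only: power_one_right)
  moreover have "(\<integral>x. x \<partial>return borel c) = c" "(\<integral>x. x\<^sup>2 \<partial>return borel c) = c\<^sup>2"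
    by (subst integral_return; simp)+
  ultimately show ?thesis
    unfolding moment_class_def using nonneg_distribution_return[OF c] by simp
qed

lemma moment_class_return_1: "moment_class 1 1 (return borel 1)"
  using moment_class_return[of 1] by (simp only: zero_le_one power_one)

text \<open>By Fubini, integrating \<open>exp (- u * x)\<close> over \<open>u\<close> gives \<open>(1 - exp (- s * x)) / x\<close>, which is the integrand of
  sigma for the unit mass at 1. All facts on sigma therefore carry over.\<close>

lemma sigma_B_eq_sigma_fun:
  assumes P: "nonneg_distribution P" and s: "0 \<le> s"
  shows "sigma_B P s = sigma_fun P 1 (return borel 1) s"
proof -
  interpret real_distribution P using P by (rule nonneg_distributionD)
  interpret pair_sigma_finite P lborel ..
  have inner: "(\<integral>\<^sup>+u. ennreal (indicator {0..s} u * exp (- (u * x))) \<partial>lborel)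
      = ennreal (sigma_integrand (return borel 1) 1 s x)" for x
  proof (rule nn_integral_has_integral_lebesgue)
    show "((\<lambda>u. exp (- (u * x))) has_integral sigma_integrand (return borel 1) 1 s x) {0..s}"
    proof (cases "x = 0")
      case True
      then show ?thesis using has_integral_const_real[of "1::real" 0 s] s by (simp add: sigma_integrand_def)
    next
      case False
      have "((\<lambda>u. exp (- (u * x))) has_integral (- exp (- (s * x)) / x - (- exp (- (0 * x)) / x))) {0..s}"
      proof (rule fundamental_theorem_of_calculus[OF s])
        fix u assume "u \<in> {0..s}"
        have "((\<lambda>u. - exp (- (u * x)) / x) has_real_derivative exp (- (u * x))) (at u within {0..s})"
          using False by (auto intro!: derivative_eq_intros)
        then show "((\<lambda>u. - exp (- (u * x)) / x) has_vector_derivative exp (- (u * x))) (at u within {0..s})"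
          by (simp add: has_real_derivative_iff_has_vector_derivative)
      qed
      then show ?thesis using False
        by (simp add: sigma_integrand_def laplace_return diff_divide_distrib mult.commute)
    qed
  qed auto
  have outer: "(\<integral>\<^sup>+u. ennreal (indicator {0..s} u * laplace_stieltjes P u) \<partial>lborel) = ennreal (sigma_B P s)"
  proof (rule nn_integral_has_integral_lebesgue)
    have "laplace_stieltjes P integrable_on {0..s}"
      by (rule integrable_continuous_real, rule continuous_on_subset[OF continuous_on_laplace[OF P]]) auto
    then show "(laplace_stieltjes P has_integral sigma_B P s) {0..s}"
      by (simp add: sigma_B_def has_integral_integral)
  qed (simp_all add: laplace_nonneg)
  have "ennreal (sigma_fun P 1 (return borel 1) s) = (\<integral>\<^sup>+x. ennreal (sigma_integrand (return borel 1) 1 s x) \<partial>P)"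
    unfolding sigma_fun_altdef
    by (rule nn_integral_eq_integral[symmetric, OF integrable_sigma_integrand[OF moment_class_return_1 P s]])
      (use nonneg_distributionD(4)[OF P] in \<open>eventually_elim, auto intro: sigma_integrand_bounds[OF moment_class_return_1 s]\<close>)
  also have "\<dots> = (\<integral>\<^sup>+x. \<integral>\<^sup>+u. ennreal (indicator {0..s} u * exp (- (u * x))) \<partial>lborel \<partial>P)"
    by (simp add: inner)
  also have "\<dots> = (\<integral>\<^sup>+u. \<integral>\<^sup>+x. ennreal (indicator {0..s} u * exp (- (u * x))) \<partial>P \<partial>lborel)"
    by (rule Fubini'[symmetric]) measurable
  also have "\<dots> = (\<integral>\<^sup>+u. ennreal (indicator {0..s} u * laplace_stieltjes P u) \<partial>lborel)"
    by (intro nn_integral_cong) (auto simp: nn_integral_laplace[OF P] split: split_indicator)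
  also have "\<dots> = ennreal (sigma_B P s)" by (rule outer)
  finally have *: "ennreal (sigma_fun P 1 (return borel 1) s) = ennreal (sigma_B P s)" .
  have "0 \<le> sigma_B P s"
    unfolding sigma_B_def
    by (rule integral_nonneg[OF integrable_continuous_real])
      (auto intro: continuous_on_subset[OF continuous_on_laplace[OF P]] laplace_nonneg)
  moreover have "0 \<le> sigma_fun P 1 (return borel 1) s"
    by (rule sigma_fun_nonneg[OF moment_class_return_1 P s])
  ultimately show ?thesis using * by simp
qed

lemma sigma_B_lipschitz:
  assumes P: "nonneg_distribution P" and u: "0 \<le> u" "0 \<le> v"
  shows "\<bar>sigma_B P u - sigma_B P v\<bar> \<le> \<bar>u - v\<bar>"
proof -
  have *: "\<bar>sigma_B P u - sigma_B P v\<bar> \<le> \<bar>u - v\<bar>" if "0 \<le> u" "u \<le> v" for u v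
  proof -
    have int: "laplace_stieltjes P integrable_on {a..b}" if "0 \<le> a" for a b
      by (rule integrable_continuous_real, rule continuous_on_subset[OF continuous_on_laplace[OF P]]) (use that in auto)
    have "sigma_B P u + integral {u..v} (laplace_stieltjes P) = sigma_B P v"
      unfolding sigma_B_def
      by (rule Henstock_Kurzweil_Integration.integral_combine) (use that int in auto)
    moreover have "0 \<le> integral {u..v} (laplace_stieltjes P)"
      using int that by (intro integral_nonneg) (auto simp: laplace_nonneg)
    moreover have "integral {u..v} (laplace_stieltjes P) \<le> integral {u..v} (\<lambda>_. 1)"
      using int that by (intro integral_le) (auto intro: laplace_le_1[OF P])
    ultimately show ?thesis using that by simp
  qed
  show ?thesis using *[of u v] *[of v u] u by (cases "u \<le> v") (auto simp: abs_minus_commute)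
qed

lemma laplace_exponent_sigma_B:
  assumes "nonneg_distribution P"
  shows "laplace_exponent (sigma_B P)"
  by (rule laplace_exponent_cong[OF laplace_exponent_sigma_fun[OF moment_class_return_1 assms]])
    (simp add: sigma_B_eq_sigma_fun[OF assms])

lemma laplace_exponential:
  assumes l: "0 < l"
  defines "E \<equiv> density lborel (exponential_density l)"
  shows "nonneg_distribution E" "0 \<le> u \<Longrightarrow> laplace_stieltjes E u = l / (l + u)"
proof -
  have total: "(\<integral>x. exponential_density r x \<partial>lborel) = 1" if "0 < r" for r
  proof -
    interpret prob_space "density lborel (exponential_density r)"
      using that by (rule prob_space_exponential_density)
    have "(\<integral>x. (1::real) \<partial>density lborel (exponential_density r)) = (\<integral>x. exponential_density r x *\<^sub>R 1 \<partial>lborel)"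
      using that by (intro integral_density) (auto simp: exponential_density_nonneg)
    then show ?thesis using prob_space by simp
  qed
  show "nonneg_distribution E"
    unfolding E_def
    by (intro nonneg_distributionI prob_space_exponential_density l)
      (auto simp: AE_density exponential_density_def)
  assume u: "0 \<le> u"
  have "laplace_stieltjes E u = (\<integral>x. exponential_density l x *\<^sub>R exp (- (u * x)) \<partial>lborel)"
    unfolding laplace_stieltjes_def E_def
    using l by (intro integral_density) (auto simp: exponential_density_nonneg)
  also have "\<dots> = (\<integral>x. l / (l + u) * exponential_density (l + u) x \<partial>lborel)"
  proof (intro Bochner_Integration.integral_cong refl)
    fix x
    have "exp (- x * l) * exp (- (u * x)) = exp (- x * (l + u))"
      by (simp add: exp_add[symmetric] algebra_simps)
    then show "exponential_density l x *\<^sub>R exp (- (u * x)) = l / (l + u) * exponential_density (l + u) x"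
      using l u by (simp add: exponential_density_def)
  qed
  also have "\<dots> = l / (l + u)" using total[of "l + u"] l u by simp
  finally show "laplace_stieltjes E u = l / (l + u)" .
qed

text \<open>The exponent of the Gamma process. For an exponential variable with mean \<open>lam\<close> the transform is
  \<open>1 / (1 + lam * u)\<close>, so the logarithm is itself a multiple of a function of the type of sigma-B.\<close>

lemma laplace_exponent_ln:
  assumes lam: "0 < lam"
  shows "laplace_exponent (\<lambda>s. ln (1 + lam * s))"
proof -
  define E where "E = density lborel (exponential_density (1 / lam))"
  have E: "nonneg_distribution E" unfolding E_def by (rule laplace_exponential) (use lam in simp)
  have LE: "laplace_stieltjes E u = 1 / (1 + lam * u)" if "0 \<le> u" for u
    using laplace_exponential(2)[of "1 / lam" u] lam that by (simp add: E_def field_simps)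
  have eq: "lam * sigma_B E s = ln (1 + lam * s)" if s: "0 \<le> s" for s
  proof -
    have "((\<lambda>u. 1 / (1 + lam * u)) has_integral (ln (1 + lam * s) / lam - ln (1 + lam * 0) / lam)) {0..s}"
    proof (rule fundamental_theorem_of_calculus[OF s])
      fix u assume "u \<in> {0..s}"
      then have "0 < 1 + lam * u" using lam by (simp add: add_pos_nonneg)
      then have "((\<lambda>u. ln (1 + lam * u) / lam) has_real_derivative 1 / (1 + lam * u)) (at u within {0..s})"
        using lam by (auto intro!: derivative_eq_intros simp: divide_simps)
      then show "((\<lambda>u. ln (1 + lam * u) / lam) has_vector_derivative 1 / (1 + lam * u)) (at u within {0..s})"
        by (simp add: has_real_derivative_iff_has_vector_derivative)
    qed
    from integral_unique[OF this]
    have "integral {0..s} (\<lambda>u. 1 / (1 + lam * u)) = ln (1 + lam * s) / lam" by simp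
    moreover have "sigma_B E s = integral {0..s} (\<lambda>u. 1 / (1 + lam * u))"
      unfolding sigma_B_def by (rule integral_cong) (simp add: LE)
    ultimately show ?thesis using lam by simp
  qed
  show ?thesis
    by (rule laplace_exponent_cong[OF laplace_exponent_scale[OF laplace_exponent_sigma_B[OF E] less_imp_le[OF lam]] eq])
qed

section \<open>Uniqueness and Lipschitz estimates for Laplace transforms\<close>

text \<open>The substitution \<open>y = exp (-x)\<close> maps the half-line into \<open>[0, 1]\<close>, and the transform at integers gives the
  moments of \<open>y\<close>. By the Weierstrass theorem they determine the integrals of continuous functions of \<open>y\<close>, and
  piecewise linear ramps recover the distribution function.\<close>

lemma laplace_unique:
  assumes F: "nonneg_distribution F" and G: "nonneg_distribution G"
    and eq: "\<And>s. 0 \<le> s \<Longrightarrow> laplace_stieltjes F s = laplace_stieltjes G s"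
  shows "F = G"
proof (rule cdf_unique)
  show "real_distribution F" "real_distribution G" using F G by (auto dest: nonneg_distributionD)
  (* A ramp of slope k that equals 1 from c on; as k grows it tends to the indicator of y >= c. *)
  define h where "h c k y = max 0 (min 1 (1 + real k * (y - c)))" for c y :: real and k :: nat
  have h01: "0 \<le> h c k y" "h c k y \<le> 1" for c k y by (auto simp: h_def)
  have ints: "integrable H (\<lambda>x. h c k (exp (-x)))" if "nonneg_distribution H" for H c k
  proof -
    interpret real_distribution H using that by (rule nonneg_distributionD)
    show ?thesis by (rule integrable_const_bound[of _ 1]) (auto simp: h_def)
  qed
  have hc: "(\<integral>x. h c k (exp (-x)) \<partial>F) = (\<integral>x. h c k (exp (-x)) \<partial>G)" for c k
  proof -
    have "\<bar>(\<integral>x. h c k (exp (-x)) \<partial>F) - (\<integral>x. h c k (exp (-x)) \<partial>G)\<bar> \<le> e" if e: "0 < e" for e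
    proof -
      have "continuous_on {0..1} (h c k)" unfolding h_def by (intro continuous_intros)
      then obtain p where p: "real_polynomial_function p" "\<And>y. y \<in> {0..1} \<Longrightarrow> \<bar>h c k y - p y\<bar> < e / 2"
        using Stone_Weierstrass_real_polynomial_function[of "{0..1}" "h c k" "e / 2"] e by auto
      then obtain a n where pa: "p = (\<lambda>x. \<Sum>i\<le>n. a i * x ^ i)"
        by (auto simp: real_polynomial_function_iff_sum)
      have pw: "exp (-x) ^ i = exp (- (real i * x))" for x :: real and i
        by (simp add: exp_of_nat_mult[symmetric])
      have near: "\<bar>(\<integral>x. h c k (exp (-x)) \<partial>H) - (\<Sum>i\<le>n. a i * laplace_stieltjes H (real i))\<bar> \<le> e / 2"
        if H: "nonneg_distribution H" for H
      proof -
        interpret real_distribution H using H by (rule nonneg_distributionD)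
        have ip: "integrable H (\<lambda>x. p (exp (-x)))"
          unfolding pa pw by (intro Bochner_Integration.integrable_sum integrable_mult_right integrable_laplace[OF H]) simp
        have "(\<integral>x. p (exp (-x)) \<partial>H) = (\<Sum>i\<le>n. a i * laplace_stieltjes H (real i))"
          unfolding pa pw laplace_stieltjes_def
          by (subst Bochner_Integration.integral_sum) (auto intro!: integrable_mult_right integrable_laplace[OF H])
        then have "\<bar>(\<integral>x. h c k (exp (-x)) \<partial>H) - (\<Sum>i\<le>n. a i * laplace_stieltjes H (real i))\<bar>
            = \<bar>\<integral>x. h c k (exp (-x)) - p (exp (-x)) \<partial>H\<bar>"
          using ints[OF H] ip by simp
        also have "\<dots> \<le> (\<integral>x. \<bar>h c k (exp (-x)) - p (exp (-x))\<bar> \<partial>H)" by (rule integral_abs_bound)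
        also have "\<dots> \<le> (\<integral>x. e / 2 \<partial>H)"
        proof (rule integral_mono_AE)
          show "integrable H (\<lambda>x. \<bar>h c k (exp (-x)) - p (exp (-x))\<bar>)"
            using ints[OF H] ip by (intro integrable_abs Bochner_Integration.integrable_diff)
          show "AE x in H. \<bar>h c k (exp (-x)) - p (exp (-x))\<bar> \<le> e / 2"
            using nonneg_distributionD(4)[OF H]
            by eventually_elim (use p(2) in \<open>auto intro: less_imp_le\<close>)
        qed simp
        also have "\<dots> = e / 2" using nonneg_distributionD(6)[OF H] by simp
        finally show ?thesis .
      qed
      have "(\<Sum>i\<le>n. a i * laplace_stieltjes F (real i)) = (\<Sum>i\<le>n. a i * laplace_stieltjes G (real i))"
        by (intro sum.cong) (auto simp: eq)
      then show ?thesis using near[OF F] near[OF G] by linarith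
    qed
    then have "\<bar>(\<integral>x. h c k (exp (-x)) \<partial>F) - (\<integral>x. h c k (exp (-x)) \<partial>G)\<bar> \<le> 0"
      by (rule field_le_epsilon) simp
    then show ?thesis by simp
  qed
  show "cdf F = cdf G"
  proof
    fix x
    have lim: "(\<lambda>k. \<integral>y. h (exp (-x)) k (exp (-y)) \<partial>H) \<longlonglongrightarrow> cdf H x" if H: "nonneg_distribution H" for H
    proof -
      interpret real_distribution H using H by (rule nonneg_distributionD)
      have "(\<lambda>k. \<integral>y. h (exp (-x)) k (exp (-y)) \<partial>H) \<longlonglongrightarrow> (\<integral>y. indicator {..x} y \<partial>H)"
      proof (rule integral_dominated_convergence[where w="\<lambda>_. 1"])
        show "AE y in H. (\<lambda>k. h (exp (-x)) k (exp (-y))) \<longlonglongrightarrow> indicator {..x} y"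
        proof (rule AE_I2)
          fix y
          show "(\<lambda>k. h (exp (-x)) k (exp (-y))) \<longlonglongrightarrow> indicator {..x} y"
          proof (cases "y \<le> x")
            case True
            then have "h (exp (-x)) k (exp (-y)) = 1" for k by (simp add: h_def)
            then show ?thesis using True by simp
          next
            case False
            define d where "d = exp (-x) - exp (-y)"
            have d: "0 < d" using False by (simp add: d_def)
            obtain N :: nat where N: "1 / d \<le> real N" using real_arch_simple by blast
            have "h (exp (-x)) k (exp (-y)) = 0" if "N \<le> k" for k
            proof -
              have "1 / d \<le> real k" using N that by linarith
              then have "1 \<le> real k * d" using d by (simp add: field_simps)
              then have "1 + real k * (exp (-y) - exp (-x)) \<le> 0" by (simp add: d_def algebra_simps)
              then show ?thesis by (simp add: h_def)
            qed
            then show ?thesis using False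
              by (intro tendsto_eventually) (auto simp: eventually_sequentially)
          qed
        qed
        show "AE y in H. norm (h (exp (-x)) k (exp (-y))) \<le> 1" for k
          using h01[of "exp (-x)" k] by simp
        show "(\<lambda>y. h (exp (-x)) k (exp (-y))) \<in> borel_measurable H" for k
          by (rule borel_measurable_integrable[OF ints[OF H]])
      qed auto
      then show ?thesis by (simp add: cdf_def)
    qed
    from lim[OF F] lim[OF G] show "cdf F x = cdf G x"
      unfolding hc by (rule LIMSEQ_unique)
  qed
qed

lemma laplace_lipschitz:
  assumes F: "nonneg_distribution F" and int: "integrable F (\<lambda>x. x)" and u: "0 \<le> u" "0 \<le> v"
  shows "\<bar>laplace_stieltjes F u - laplace_stieltjes F v\<bar> \<le> (\<integral>x. x \<partial>F) * \<bar>u - v\<bar>"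
proof -
  have *: "\<bar>laplace_stieltjes F u - laplace_stieltjes F v\<bar> \<le> (\<integral>x. x \<partial>F) * \<bar>u - v\<bar>"
    if uv: "0 \<le> u" "u \<le> v" for u v
  proof -
    have "laplace_stieltjes F u - laplace_stieltjes F v = (\<integral>x. exp (- (u * x)) - exp (- (v * x)) \<partial>F)"
      using integrable_laplace[OF F, of u] integrable_laplace[OF F, of v] uv
      by (simp add: laplace_stieltjes_def)
    also have "\<dots> \<le> (\<integral>x. (v - u) * x \<partial>F)"
    proof (rule integral_mono_AE)
      show "AE x in F. exp (- (u * x)) - exp (- (v * x)) \<le> (v - u) * x"
        using nonneg_distributionD(4)[OF F]
      proof eventually_elim
        case (elim x)
        have "exp (- (u * x)) - exp (- (v * x)) = exp (- (u * x)) * (1 - exp (- ((v - u) * x)))"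
          by (simp add: algebra_simps exp_add[symmetric])
        also have "\<dots> \<le> 1 * (1 - exp (- ((v - u) * x)))"
          using elim uv by (intro mult_right_mono) auto
        also have "\<dots> \<le> (v - u) * x"
          using exp_taylor_bounds(2)[of "(v - u) * x"] elim uv by simp
        finally show ?case .
      qed
    qed (use integrable_laplace[OF F, of u] integrable_laplace[OF F, of v] uv int in auto)
    finally show ?thesis using laplace_antimono[OF F uv] uv by (simp add: mult.commute)
  qed
  show ?thesis using *[of u v] *[of v u] u by (cases "u \<le> v") (auto simp: abs_minus_commute)
qed

lemma laplace_less_1:
  assumes F: "nonneg_distribution F" and int: "integrable F (\<lambda>x. x)" and pos: "0 < (\<integral>x. x \<partial>F)" and s: "0 < s"
  shows "laplace_stieltjes F s < 1"
proof (rule ccontr)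
  interpret real_distribution F using F by (rule nonneg_distributionD)
  assume "\<not> laplace_stieltjes F s < 1"
  then have "laplace_stieltjes F s = 1" using laplace_le_1[OF F, of s] s by simp
  then have "(\<integral>x. 1 - exp (- (s * x)) \<partial>F) = 0"
    using integrable_laplace[OF F, of s] nonneg_distributionD(6)[OF F] s
    by (simp add: laplace_stieltjes_def)
  moreover have "integrable F (\<lambda>x. 1 - exp (- (s * x)))"
    using integrable_laplace[OF F, of s] s by simp
  moreover have "AE x in F. 0 \<le> 1 - exp (- (s * x))"
    using nonneg_distributionD(4)[OF F] by eventually_elim (use s in auto)
  ultimately have "AE x in F. 1 - exp (- (s * x)) = 0"
    by (simp only: integral_nonneg_eq_0_iff_AE)
  then have "AE x in F. x = 0" by eventually_elim (use s in auto)
  then have "(\<integral>x. x \<partial>F) = 0" by (rule integral_eq_zero_AE)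
  with pos show False by simp
qed

lemma ln_one_plus_bounds:
  fixes x :: real assumes "0 \<le> x"
  shows "0 \<le> ln (1 + x)" "ln (1 + x) \<le> x" "x - ln (1 + x) \<le> x\<^sup>2 / 2"
proof -
  show "0 \<le> ln (1 + x)" "ln (1 + x) \<le> x" using assms by (auto intro: ln_add_one_self_le_self)
  have "0\<^sup>2 / 2 - (0 - ln (1 + 0)) \<le> x\<^sup>2 / 2 - (x - ln (1 + x))"
  proof (rule DERIV_nonneg_imp_nondecreasing[OF assms])
    fix u :: real assume u: "0 \<le> u"
    have "((\<lambda>x. x\<^sup>2 / 2 - (x - ln (1 + x))) has_real_derivative u - (1 - 1 / (1 + u))) (at u)"
      using u by (auto intro!: derivative_eq_intros)
    moreover have "0 \<le> u - (1 - 1 / (1 + u))" using u by (simp add: field_simps)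
    ultimately show "\<exists>y. ((\<lambda>x. x\<^sup>2 / 2 - (x - ln (1 + x))) has_real_derivative y) (at u) \<and> 0 \<le> y"
      by blast
  qed
  then show "x - ln (1 + x) \<le> x\<^sup>2 / 2" by simp
qed

lemma ln_one_plus_lipschitz:
  fixes p q :: real assumes "0 \<le> p" "0 \<le> q"
  shows "\<bar>ln (1 + p) - ln (1 + q)\<bar> \<le> \<bar>p - q\<bar>"
proof -
  have *: "ln (1 + p) - ln (1 + q) \<le> p - q" if "0 \<le> q" "q \<le> p" for p q :: real
  proof -
    have "ln (1 + p) - ln (1 + q) \<le> ((1 + p) - (1 + q)) / (1 + q)"
      using that by (intro ln_diff_le) auto
    also have "\<dots> \<le> p - q" using that by (simp add: pos_divide_le_eq mult_le_cancel_left1)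
    finally show ?thesis .
  qed
  have mono: "ln (1 + q) \<le> ln (1 + p)" if "0 \<le> q" "q \<le> p" for p q :: real
    using that by simp
  show ?thesis
    using *[of p q] *[of q p] mono[of p q] mono[of q p] assms by (cases "p \<le> q") auto
qed

section \<open>The map whose fixed points are the solutions\<close>

text \<open>The right-hand side of the functional equation, written as the transform of \<open>A\<close> at the logarithm of the base.\<close>

definition solution_map ::
  "real measure \<Rightarrow> real measure \<Rightarrow> real measure \<Rightarrow> real \<Rightarrow> real \<Rightarrow> real measure \<Rightarrow> real \<Rightarrow> real" where
  "solution_map F\<^sub>T F\<^sub>A F\<^sub>B lam \<mu> F s =
     laplace_stieltjes F\<^sub>A (ln (1 + lam * sigma_B F\<^sub>B (sigma_fun F\<^sub>T \<mu> F s)))"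

lemma sigma_B_bounds:
  assumes P: "nonneg_distribution P" and u: "0 \<le> u"
  shows "0 \<le> sigma_B P u" "sigma_B P u \<le> u"
    "integrable P (\<lambda>t. t) \<Longrightarrow> u - sigma_B P u \<le> (\<integral>t. t \<partial>P) / 2 * u\<^sup>2"
  using sigma_fun_nonneg[OF moment_class_return_1 P u] sigma_fun_le[OF moment_class_return_1 P u]
    sigma_fun_second_order_bound[OF moment_class_return_1 P u]
  by (simp_all add: sigma_B_eq_sigma_fun[OF P u])

lemma moment_class_variance:
  assumes "moment_class \<mu> K F"
  shows "integrable F (\<lambda>x. (x - \<mu>)\<^sup>2)" "(\<integral>x. (x - \<mu>)\<^sup>2 \<partial>F) = (\<integral>x. x\<^sup>2 \<partial>F) - \<mu>\<^sup>2"
proof -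
  have *: "nonneg_distribution F" "integrable F (\<lambda>x. x)" "(\<integral>x. x \<partial>F) = \<mu>" "integrable F (\<lambda>x. x\<^sup>2)"
    using assms by (auto simp: moment_class_def)
  interpret real_distribution F using *(1) by (rule nonneg_distributionD)
  have eq: "(x - \<mu>)\<^sup>2 = x\<^sup>2 - 2 * \<mu> * x + \<mu>\<^sup>2" for x by (simp add: power2_eq_square algebra_simps)
  show "integrable F (\<lambda>x. (x - \<mu>)\<^sup>2)" unfolding eq using * by auto
  show "(\<integral>x. (x - \<mu>)\<^sup>2 \<partial>F) = (\<integral>x. x\<^sup>2 \<partial>F) - \<mu>\<^sup>2"
    unfolding eq using * nonneg_distributionD(6)[OF *(1)] by (simp add: power2_eq_square)
qed

lemma is_solution_iff:
  assumes T: "nonneg_distribution F\<^sub>T" and A: "nonneg_distribution F\<^sub>A" and B: "nonneg_distribution F\<^sub>B"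
    and lam: "0 < lam"
  shows "is_solution F\<^sub>T F\<^sub>A F\<^sub>B lam \<mu> F \<longleftrightarrow>
    (\<exists>K. moment_class \<mu> K F) \<and> (\<forall>s\<ge>0. laplace_stieltjes F s = solution_map F\<^sub>T F\<^sub>A F\<^sub>B lam \<mu> F s)"
proof -
  have mc: "(nonneg_distribution F \<and> integrable F (\<lambda>x. x) \<and> (\<integral>x. x \<partial>F) = \<mu> \<and> integrable F (\<lambda>x. (x - \<mu>)\<^sup>2))
     \<longleftrightarrow> (\<exists>K. moment_class \<mu> K F)"
  proof
    assume *: "nonneg_distribution F \<and> integrable F (\<lambda>x. x) \<and> (\<integral>x. x \<partial>F) = \<mu> \<and> integrable F (\<lambda>x. (x - \<mu>)\<^sup>2)"
    then interpret real_distribution F by (auto dest: nonneg_distributionD)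
    have "integrable F (\<lambda>x. (x - \<mu>)\<^sup>2 + 2 * \<mu> * x - \<mu>\<^sup>2)" using * by auto
    also have "(\<lambda>x. (x - \<mu>)\<^sup>2 + 2 * \<mu> * x - \<mu>\<^sup>2) = (\<lambda>x. x\<^sup>2)"
      by (simp add: fun_eq_iff power2_eq_square algebra_simps)
    finally have "integrable F (\<lambda>x. x\<^sup>2)" .
    with * have "moment_class \<mu> (\<integral>x. x\<^sup>2 \<partial>F) F" by (simp add: moment_class_def)
    then show "\<exists>K. moment_class \<mu> K F" ..
  qed (auto simp: moment_class_variance moment_class_def)
  have "satisfies_equation F\<^sub>T F\<^sub>A F\<^sub>B lam \<mu> F \<longleftrightarrow>
      (\<forall>s\<ge>0. laplace_stieltjes F s = solution_map F\<^sub>T F\<^sub>A F\<^sub>B lam \<mu> F s)" if "moment_class \<mu> K F" for K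
  proof -
    have "(\<integral>a. 1 / (1 + lam * sigma_B F\<^sub>B (sigma_fun F\<^sub>T \<mu> F s)) powr a \<partial>F\<^sub>A) = solution_map F\<^sub>T F\<^sub>A F\<^sub>B lam \<mu> F s"
      if "0 \<le> s" for s
    proof -
      have "0 < 1 + lam * sigma_B F\<^sub>B (sigma_fun F\<^sub>T \<mu> F s)"
        using sigma_fun_nonneg[OF \<open>moment_class \<mu> K F\<close> T that] sigma_B_bounds(1)[OF B] lam
        by (simp add: add_pos_nonneg)
      then show ?thesis
        unfolding solution_map_def laplace_stieltjes_def
        by (intro Bochner_Integration.integral_cong)
          (auto simp: powr_def exp_minus field_simps)
    qed
    then show ?thesis by (simp add: satisfies_equation_def)
  qed
  with mc show ?thesis unfolding is_solution_def by blast
qed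

text \<open>The argument of the transform of \<open>A\<close> is a composition of three Laplace exponents: the logarithm, sigma-B
  and sigma.\<close>

lemma laplace_class_solution_map:
  assumes T: "nonneg_distribution F\<^sub>T" and A: "nonneg_distribution F\<^sub>A" and B: "nonneg_distribution F\<^sub>B"
    and lam: "0 < lam" and F: "moment_class \<mu> K F"
  shows "laplace_class (solution_map F\<^sub>T F\<^sub>A F\<^sub>B lam \<mu> F)"
proof -
  have "laplace_exponent (\<lambda>s. sigma_B F\<^sub>B (sigma_fun F\<^sub>T \<mu> F s))"
    by (rule laplace_exponent_compose[OF laplace_exponent_sigma_B[OF B] laplace_exponent_sigma_fun[OF F T]])
  from laplace_class_subordination[OF laplace_exponent_compose[OF laplace_exponent_ln[OF lam] this] A]
  show ?thesis unfolding solution_map_def .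
qed

section \<open>Existence and uniqueness under the moment conditions\<close>

text \<open>Outside sigma every layer is a weak contraction: sigma-B has slope at most 1, the logarithm has slope at
  most \<open>lam\<close>, and the transform of \<open>A\<close> has slope at most \<open>1 / lam\<close>, the mean of \<open>A\<close>.\<close>

lemma solution_map_contraction:
  assumes T: "nonneg_distribution F\<^sub>T" and A: "nonneg_distribution F\<^sub>A" and B: "nonneg_distribution F\<^sub>B"
    and lam: "0 < lam"
    and intT: "integrable F\<^sub>T (\<lambda>t. t)" and intA: "integrable F\<^sub>A (\<lambda>a. a)" and meanA: "(\<integral>a. a \<partial>F\<^sub>A) = 1 / lam"
    and F: "moment_class \<mu> K F" and G: "moment_class \<mu> K G" and s: "0 \<le> s"
    and D: "\<And>u. 0 \<le> u \<Longrightarrow> \<bar>laplace_stieltjes F u - laplace_stieltjes G u\<bar> \<le> D * u\<^sup>2"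
  shows "\<bar>solution_map F\<^sub>T F\<^sub>A F\<^sub>B lam \<mu> F s - solution_map F\<^sub>T F\<^sub>A F\<^sub>B lam \<mu> G s\<bar>
      \<le> \<bar>sigma_fun F\<^sub>T \<mu> F s - sigma_fun F\<^sub>T \<mu> G s\<bar>"
    and "\<bar>solution_map F\<^sub>T F\<^sub>A F\<^sub>B lam \<mu> F s - solution_map F\<^sub>T F\<^sub>A F\<^sub>B lam \<mu> G s\<bar>
      \<le> (\<integral>t. t \<partial>F\<^sub>T) * D * s\<^sup>2"
proof -
  let ?f = "sigma_fun F\<^sub>T \<mu> F s" and ?g = "sigma_fun F\<^sub>T \<mu> G s"
  let ?p = "lam * sigma_B F\<^sub>B ?f" and ?q = "lam * sigma_B F\<^sub>B ?g"
  have fg: "0 \<le> ?f" "0 \<le> ?g" by (rule sigma_fun_nonneg[OF F T s], rule sigma_fun_nonneg[OF G T s])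
  have pq: "0 \<le> ?p" "0 \<le> ?q" using sigma_B_bounds(1)[OF B] fg lam by simp_all
  have "\<bar>solution_map F\<^sub>T F\<^sub>A F\<^sub>B lam \<mu> F s - solution_map F\<^sub>T F\<^sub>A F\<^sub>B lam \<mu> G s\<bar>
      \<le> 1 / lam * \<bar>ln (1 + ?p) - ln (1 + ?q)\<bar>"
    unfolding solution_map_def meanA[symmetric]
    by (rule laplace_lipschitz[OF A intA]) (use pq ln_one_plus_bounds(1) in auto)
  also have "\<dots> \<le> 1 / lam * \<bar>?p - ?q\<bar>"
    using lam by (intro mult_left_mono ln_one_plus_lipschitz pq) auto
  also have "\<dots> = \<bar>sigma_B F\<^sub>B ?f - sigma_B F\<^sub>B ?g\<bar>"
    using lam by (simp add: right_diff_distrib[symmetric] abs_mult)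
  also have "\<dots> \<le> \<bar>?f - ?g\<bar>" by (rule sigma_B_lipschitz[OF B fg])
  finally show *: "\<bar>solution_map F\<^sub>T F\<^sub>A F\<^sub>B lam \<mu> F s - solution_map F\<^sub>T F\<^sub>A F\<^sub>B lam \<mu> G s\<bar> \<le> \<bar>?f - ?g\<bar>" .
  also have "\<bar>?f - ?g\<bar> \<le> (\<integral>t. t \<partial>F\<^sub>T) * D * s\<^sup>2"
    by (rule sigma_fun_contraction[OF F G T intT s D])
  finally show "\<bar>solution_map F\<^sub>T F\<^sub>A F\<^sub>B lam \<mu> F s - solution_map F\<^sub>T F\<^sub>A F\<^sub>B lam \<mu> G s\<bar>
      \<le> (\<integral>t. t \<partial>F\<^sub>T) * D * s\<^sup>2" .
qed

lemma moment_class_laplace_dist: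
  assumes F: "moment_class \<mu> K F" and G: "moment_class \<mu> K G" and "0 \<le> u"
  shows "\<bar>laplace_stieltjes F u - laplace_stieltjes G u\<bar> \<le> K / 2 * u\<^sup>2"
  using moment_classD(4,5)[OF F assms(3)] moment_classD(4,5)[OF G assms(3)] by linarith

context
  fixes F\<^sub>T F\<^sub>A F\<^sub>B :: "real measure" and lam \<mu> :: real
  assumes T: "nonneg_distribution F\<^sub>T" and A: "nonneg_distribution F\<^sub>A" and B: "nonneg_distribution F\<^sub>B"
    and lam: "0 < lam" and mu: "0 < \<mu>"
begin

text \<open>The constant \<open>K\<close> is the second moment that a solution must have; the expansion of the equation shows that
  the class of distributions with mean \<open>\<mu>\<close> and second moment at most \<open>K\<close> is mapped to itself. On this class the map
  contracts by \<open>\<tau> = E T < 1\<close> in the distance \<open>sup \<bar>\<dots>\<bar> / s\<^sup>2\<close>. Hence the iterates started at the unit mass at \<open>\<mu>\<close>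
  converge, the limit stays in the class by the continuity theorem, and the fixed point is unique.\<close>

lemma ex1_solution:
  assumes intT: "integrable F\<^sub>T (\<lambda>t. t)" and T1: "(\<integral>t. t \<partial>F\<^sub>T) < 1"
    and intA: "integrable F\<^sub>A (\<lambda>a. a)" and meanA: "(\<integral>a. a \<partial>F\<^sub>A) = 1 / lam"
    and intA2: "integrable F\<^sub>A (\<lambda>a. a\<^sup>2)" and intB: "integrable F\<^sub>B (\<lambda>b. b)"
  shows "\<exists>!F. is_solution F\<^sub>T F\<^sub>A F\<^sub>B lam \<mu> F"
proof -
  let ?\<Psi> = "solution_map F\<^sub>T F\<^sub>A F\<^sub>B lam \<mu>"
  define \<tau> where "\<tau> = (\<integral>t. t \<partial>F\<^sub>T)"
  define \<beta> where "\<beta> = (\<integral>b. b \<partial>F\<^sub>B)"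
  define a2 where "a2 = (\<integral>a. a\<^sup>2 \<partial>F\<^sub>A)"
  define K where "K = \<mu>\<^sup>2 * (\<beta> + lam + lam\<^sup>2 * a2) / (1 - \<tau>)"
  have \<tau>: "0 \<le> \<tau>" "\<tau> < 1"
    using nonneg_distributionD(4)[OF T] T1 by (auto simp: \<tau>_def intro: integral_nonneg_AE)
  have \<beta>: "0 \<le> \<beta>" using nonneg_distributionD(4)[OF B] by (auto simp: \<beta>_def intro: integral_nonneg_AE)
  have mA: "moment_class (1 / lam) a2 F\<^sub>A"
    using A intA meanA intA2 by (simp add: moment_class_def a2_def)
  (* The variance of A is nonnegative, which gives mu^2 <= K: the starting point of the
     iteration lies in the invariant class. *)
  have "0 \<le> (\<integral>a. (a - 1 / lam)\<^sup>2 \<partial>F\<^sub>A)" by simp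
  then have "(1 / lam)\<^sup>2 \<le> a2" using moment_class_variance(2)[OF mA] by (simp add: a2_def)
  then have "lam\<^sup>2 * (1 / lam)\<^sup>2 \<le> lam\<^sup>2 * a2" by (intro mult_left_mono) auto
  then have a2: "1 \<le> lam\<^sup>2 * a2" using lam by (simp add: power_divide)
  have "\<mu>\<^sup>2 * 1 \<le> \<mu>\<^sup>2 * (\<beta> + lam + lam\<^sup>2 * a2)" using \<beta> lam a2 by (intro mult_left_mono) auto
  then have "\<mu>\<^sup>2 * (1 - \<tau>) \<le> \<mu>\<^sup>2 * (\<beta> + lam + lam\<^sup>2 * a2)"
    using \<tau>(1) mult_left_mono[of "1 - \<tau>" 1 "\<mu>\<^sup>2"] by simp
  then have K\<mu>: "\<mu>\<^sup>2 \<le> K" using \<tau> by (simp add: K_def pos_le_divide_eq)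
  have bounds: "0 \<le> ?\<Psi> F s - 1 + \<mu> * s" "?\<Psi> F s - 1 + \<mu> * s \<le> K / 2 * s\<^sup>2"
    if F: "moment_class \<mu> K F" and s: "0 \<le> s" for F s
  proof -
    define g where "g = sigma_fun F\<^sub>T \<mu> F s"
    define b where "b = sigma_B F\<^sub>B g"
    define x where "x = lam * b"
    define w where "w = ln (1 + x)"
    have g: "0 \<le> g" "g \<le> \<mu> * s" "\<mu> * s - g \<le> \<tau> * K / 2 * s\<^sup>2"
      using sigma_fun_nonneg[OF F T s] sigma_fun_le[OF F T s] sigma_fun_second_order_bound[OF F T s intT]
      by (auto simp: g_def \<tau>_def)
    have b: "0 \<le> b" "b \<le> g" "g - b \<le> \<beta> / 2 * g\<^sup>2"
      using sigma_B_bounds[OF B g(1)] intB by (auto simp: b_def \<beta>_def)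
    have x: "0 \<le> x" "x \<le> lam * (\<mu> * s)" using b g lam by (auto simp: x_def)
    have w: "0 \<le> w" "w \<le> x" "x - w \<le> x\<^sup>2 / 2" using ln_one_plus_bounds[OF x(1)] by (auto simp: w_def)
    have \<Psi>: "?\<Psi> F s = laplace_stieltjes F\<^sub>A w"
      by (simp add: solution_map_def w_def x_def b_def g_def)
    have L: "0 \<le> laplace_stieltjes F\<^sub>A w - 1 + 1 / lam * w" "laplace_stieltjes F\<^sub>A w - 1 + 1 / lam * w \<le> a2 / 2 * w\<^sup>2"
      using moment_classD(4,5)[OF mA w(1)] by auto
    (* The four summands are the second-order errors of the transform of A, of sigma, of
       sigma-B and of the logarithm; the linear terms telescope because A has mean 1 / lam. *)
    have split: "?\<Psi> F s - 1 + \<mu> * s = (laplace_stieltjes F\<^sub>A w - 1 + 1 / lam * w) + (\<mu> * s - g) + (g - b) + 1 / lam * (x - w)"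
      using lam by (simp add: \<Psi> x_def field_simps)
    show "0 \<le> ?\<Psi> F s - 1 + \<mu> * s"
    proof -
      have "0 \<le> 1 / lam * (x - w)" using w lam by (intro mult_nonneg_nonneg) auto
      then show ?thesis unfolding split using L(1) g(2) b(2) by linarith
    qed
    have "w\<^sup>2 \<le> (lam * (\<mu> * s))\<^sup>2" using w x by (intro power_mono) auto
    then have "a2 / 2 * w\<^sup>2 \<le> a2 / 2 * (lam * (\<mu> * s))\<^sup>2"
      using moment_classD(3)[OF mA] by (intro mult_left_mono) auto
    moreover have "g\<^sup>2 \<le> (\<mu> * s)\<^sup>2" using g by (intro power_mono) auto
    then have "\<beta> / 2 * g\<^sup>2 \<le> \<beta> / 2 * (\<mu> * s)\<^sup>2" using \<beta> by (intro mult_left_mono) auto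
    moreover have "x\<^sup>2 \<le> (lam * (\<mu> * s))\<^sup>2" using x by (intro power_mono) auto
    then have "1 / lam * (x - w) \<le> 1 / lam * ((lam * (\<mu> * s))\<^sup>2 / 2)"
      using w lam by (intro mult_left_mono) auto
    ultimately have "?\<Psi> F s - 1 + \<mu> * s \<le> a2 / 2 * (lam * (\<mu> * s))\<^sup>2 + \<tau> * K / 2 * s\<^sup>2 + \<beta> / 2 * (\<mu> * s)\<^sup>2
        + 1 / lam * ((lam * (\<mu> * s))\<^sup>2 / 2)"
      unfolding split using L g b by linarith
    also have "\<dots> = (\<mu>\<^sup>2 * (\<beta> + lam + lam\<^sup>2 * a2) + \<tau> * K) / 2 * s\<^sup>2"
      using lam by (simp add: field_simps power2_eq_square)
    also have "\<mu>\<^sup>2 * (\<beta> + lam + lam\<^sup>2 * a2) + \<tau> * K = K"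
    proof -
      have "(1 - \<tau>) * K = \<mu>\<^sup>2 * (\<beta> + lam + lam\<^sup>2 * a2)" using \<tau> by (simp add: K_def)
      then show ?thesis by (simp add: algebra_simps)
    qed
    finally show "?\<Psi> F s - 1 + \<mu> * s \<le> K / 2 * s\<^sup>2" .
  qed
  have step: "\<exists>G. moment_class \<mu> K G \<and> (\<forall>s\<ge>0. laplace_stieltjes G s = ?\<Psi> F s)" if F: "moment_class \<mu> K F" for F
  proof -
    obtain G where G: "nonneg_distribution G" "\<And>s. 0 \<le> s \<Longrightarrow> laplace_stieltjes G s = ?\<Psi> F s"
      using laplace_class_solution_map[OF T A B lam F] by (auto simp: laplace_class_def)
    have "moment_class \<mu> K G"
      by (rule moment_classI[OF G(1)]) (use G(2) bounds[OF F] in auto)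
    with G show ?thesis by blast
  qed
  note contraction = solution_map_contraction[OF T A B lam intT intA meanA, folded \<tau>_def]
  have "moment_class \<mu> K (return borel \<mu>)"
    using moment_class_return[of \<mu>] mu K\<mu> by (auto simp: moment_class_def)
  then obtain F where F: "\<And>n. moment_class \<mu> K (F n)"
    and FS: "\<And>n s. 0 \<le> s \<Longrightarrow> laplace_stieltjes (F (Suc n)) s = ?\<Psi> (F n) s"
    using dependent_nat_choice[of "\<lambda>_ G. moment_class \<mu> K G" "\<lambda>_ G H. \<forall>s\<ge>0. laplace_stieltjes H s = ?\<Psi> G s"]
      step by metis
  have geo: "\<bar>laplace_stieltjes (F (Suc n)) s - laplace_stieltjes (F n) s\<bar> \<le> \<tau> ^ n * (K / 2) * s\<^sup>2"
    if "0 \<le> s" for n s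
    using that
  proof (induction n arbitrary: s)
    case 0
    then show ?case using moment_class_laplace_dist[OF F F] by simp
  next
    case (Suc n)
    from contraction(2)[OF F F Suc.prems Suc.IH] show ?case
      using Suc.prems by (simp add: FS mult_ac)
  qed
  have "\<exists>l. (\<lambda>n. laplace_stieltjes (F n) s) \<longlonglongrightarrow> l" if s: "0 \<le> s" for s
  proof -
    have "summable (\<lambda>n. laplace_stieltjes (F (Suc n)) s - laplace_stieltjes (F n) s)"
    proof (rule summable_comparison_test')
      show "summable (\<lambda>n. \<tau> ^ n * (K / 2 * s\<^sup>2))"
        using \<tau> by (intro summable_mult2 summable_geometric) auto
      show "norm (laplace_stieltjes (F (Suc n)) s - laplace_stieltjes (F n) s) \<le> \<tau> ^ n * (K / 2 * s\<^sup>2)" for n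
        using geo[OF s, of n] by (simp add: mult_ac)
    qed
    from summable_LIMSEQ[OF this] obtain l where "(\<lambda>n. laplace_stieltjes (F n) s - laplace_stieltjes (F 0) s) \<longlonglongrightarrow> l"
      unfolding sum_lessThan_telescope[of "\<lambda>n. laplace_stieltjes (F n) s"] by blast
    from tendsto_add[OF this tendsto_const[of "laplace_stieltjes (F 0) s"]] show ?thesis by auto
  qed
  then obtain \<phi> where \<phi>: "\<And>s. 0 \<le> s \<Longrightarrow> (\<lambda>n. laplace_stieltjes (F n) s) \<longlonglongrightarrow> \<phi> s" by metis
  have \<phi>_bounds: "0 \<le> \<phi> s - 1 + \<mu> * s" "\<phi> s - 1 + \<mu> * s \<le> K / 2 * s\<^sup>2" "\<phi> s \<le> 1" if s: "0 \<le> s" for s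
  proof -
    have lim: "(\<lambda>n. laplace_stieltjes (F n) s - 1 + \<mu> * s) \<longlonglongrightarrow> \<phi> s - 1 + \<mu> * s"
      by (intro tendsto_intros \<phi> s)
    show "0 \<le> \<phi> s - 1 + \<mu> * s" "\<phi> s - 1 + \<mu> * s \<le> K / 2 * s\<^sup>2"
      using LIMSEQ_le_const[OF lim] LIMSEQ_le_const2[OF lim] moment_classD(4,5)[OF F s] by blast+
    show "\<phi> s \<le> 1"
      using LIMSEQ_le_const2[OF \<phi>[OF s]] laplace_le_1[OF moment_classD(1)[OF F] s] by blast
  qed
  have "laplace_class \<phi>"
  proof (rule laplace_class_limit[OF _ \<phi>])
    show "laplace_class (laplace_stieltjes (F n))" for n
      using moment_classD(1)[OF F] by (auto simp: laplace_class_def)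
    show "(\<phi> \<longlongrightarrow> 1) (at_right 0)"
    proof (rule real_tendsto_sandwich[where f="\<lambda>s. 1 - \<mu> * s" and h="\<lambda>_. 1"])
      have "((\<lambda>s. 1 - \<mu> * s) \<longlongrightarrow> 1 - \<mu> * 0) (at_right 0)" by (intro tendsto_intros)
      then show "((\<lambda>s. 1 - \<mu> * s) \<longlongrightarrow> 1) (at_right 0)" by simp
      show "eventually (\<lambda>s. 1 - \<mu> * s \<le> \<phi> s) (at_right 0)"
        using eventually_at_right_less[of 0]
      proof eventually_elim
        case (elim s)
        then show ?case using \<phi>_bounds(1)[of s] by simp
      qed
      show "eventually (\<lambda>s. \<phi> s \<le> 1) (at_right 0)"
        using eventually_at_right_less[of 0] by eventually_elim (simp add: \<phi>_bounds)
    qed simp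
  qed
  then obtain G where G: "nonneg_distribution G" and LG: "\<And>s. 0 \<le> s \<Longrightarrow> laplace_stieltjes G s = \<phi> s"
    by (auto simp: laplace_class_def)
  have mG: "moment_class \<mu> K G"
    by (rule moment_classI[OF G]) (use \<phi>_bounds LG in auto)
  have fix_G: "laplace_stieltjes G s = ?\<Psi> G s" if s: "0 \<le> s" for s
  proof -
    have "(\<lambda>n. sigma_fun F\<^sub>T \<mu> (F n) s - sigma_fun F\<^sub>T \<mu> G s) \<longlonglongrightarrow> 0"
      using sigma_fun_LIMSEQ[OF F mG T s] \<phi> LG by (simp add: LIM_zero)
    then have "(\<lambda>n. ?\<Psi> (F n) s - ?\<Psi> G s) \<longlonglongrightarrow> 0"
      by (rule Lim_null_comparison[rotated, OF tendsto_rabs_zero])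
        (use contraction(1)[OF F mG s moment_class_laplace_dist[OF F mG]] in auto)
    then have "(\<lambda>n. ?\<Psi> (F n) s) \<longlonglongrightarrow> ?\<Psi> G s" by (rule LIM_zero_cancel)
    moreover have "(\<lambda>n. ?\<Psi> (F n) s) \<longlonglongrightarrow> \<phi> s"
      using LIMSEQ_Suc[OF \<phi>[OF s]] by (simp add: FS s)
    ultimately show ?thesis using LG[OF s] LIMSEQ_unique by metis
  qed
  note iff = is_solution_iff[OF T A B lam]
  show ?thesis
  proof (rule ex1I[of _ G])
    show "is_solution F\<^sub>T F\<^sub>A F\<^sub>B lam \<mu> G" unfolding iff using mG fix_G by blast
  next
    fix H assume "is_solution F\<^sub>T F\<^sub>A F\<^sub>B lam \<mu> H"
    then obtain K' where H: "moment_class \<mu> K' H" and fix_H: "\<And>s. 0 \<le> s \<Longrightarrow> laplace_stieltjes H s = ?\<Psi> H s"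
      unfolding iff by blast
    define C where "C = max K K'"
    have mC: "moment_class \<mu> C G" "moment_class \<mu> C H"
      using mG H by (auto simp: moment_class_def C_def)
    (* Two fixed points: applying the contraction n times to their initial quadratic distance. *)
    have "\<bar>laplace_stieltjes H s - laplace_stieltjes G s\<bar> \<le> \<tau> ^ n * (C / 2) * s\<^sup>2" if "0 \<le> s" for n s
      using that
    proof (induction n arbitrary: s)
      case 0
      then show ?case using moment_class_laplace_dist[OF mC(2,1)] by simp
    next
      case (Suc n)
      have "\<bar>?\<Psi> H s - ?\<Psi> G s\<bar> \<le> \<tau> * (\<tau> ^ n * (C / 2)) * s\<^sup>2"
        by (rule contraction(2)[OF mC(2,1) Suc.prems Suc.IH])
      then show ?case using fix_H[OF Suc.prems] fix_G[OF Suc.prems] by (simp add: mult_ac)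
    qed
    note bnd = this
    have "laplace_stieltjes H s = laplace_stieltjes G s" if s: "0 \<le> s" for s
    proof -
      have "(\<lambda>n. \<tau> ^ n * (C / 2) * s\<^sup>2) \<longlonglongrightarrow> 0 * (C / 2) * s\<^sup>2"
        using \<tau> by (intro tendsto_intros LIMSEQ_realpow_zero) auto
      then have "(\<lambda>n. \<tau> ^ n * (C / 2) * s\<^sup>2) \<longlonglongrightarrow> 0" by simp
      from LIMSEQ_le_const[OF this] bnd[OF s]
      have "\<bar>laplace_stieltjes H s - laplace_stieltjes G s\<bar> \<le> 0" by blast
      then show ?thesis by simp
    qed
    then show "H = G" using moment_classD(1)[OF H] G by (intro laplace_unique)
  qed
qed

section \<open>Moment conditions forced by a solution\<close>

text \<open>Write \<open>g\<close> for sigma, \<open>b\<close> for sigma-B of \<open>g\<close>, \<open>x = lam * b\<close> and \<open>w = ln (1 + x)\<close>, so that the equation reads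
  \<open>laplace_stieltjes F s = laplace_stieltjes F\<^sub>A w\<close>. First-order comparison at \<open>s \<rightarrow> 0\<close> yields the mean of \<open>A\<close>. The
  second-order remainder of \<open>F\<close> then splits into four nonnegative terms, belonging to \<open>A\<close>, \<open>T\<close>, \<open>B\<close> and the
  logarithm. Each is bounded by the remainder of \<open>F\<close>, which makes the moments finite; passing to the limit yields an
  identity for the second moment, and its positive right-hand side forces the mean of \<open>T\<close> below 1.\<close>

lemma moments_from_solution:
  assumes F: "moment_class \<mu> K F"
    and fixpoint: "\<And>s. 0 \<le> s \<Longrightarrow> laplace_stieltjes F s = solution_map F\<^sub>T F\<^sub>A F\<^sub>B lam \<mu> F s"
  shows "integrable F\<^sub>T (\<lambda>t. t)" "(\<integral>t. t \<partial>F\<^sub>T) < 1"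
    "integrable F\<^sub>A (\<lambda>a. a)" "(\<integral>a. a \<partial>F\<^sub>A) = 1 / lam" "integrable F\<^sub>A (\<lambda>a. a\<^sup>2)" "integrable F\<^sub>B (\<lambda>b. b)"
    "(\<integral>x. x\<^sup>2 \<partial>F) * (1 - (\<integral>t. t \<partial>F\<^sub>T)) = \<mu>\<^sup>2 * ((\<integral>b. b \<partial>F\<^sub>B) + lam + lam\<^sup>2 * (\<integral>a. a\<^sup>2 \<partial>F\<^sub>A))"
proof -
  have F': "nonneg_distribution F" "integrable F (\<lambda>x. x)" "(\<integral>x. x \<partial>F) = \<mu>" "integrable F (\<lambda>x. x\<^sup>2)"
    using F by (auto simp: moment_class_def)
  define m2 where "m2 = (\<integral>x. x\<^sup>2 \<partial>F)"
  define S where "S n = 1 / real (Suc n)" for n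
  have S: "0 < S n" "S \<longlonglongrightarrow> 0" for n
    using LIMSEQ_inverse_real_of_nat unfolding S_def by (simp_all only: inverse_eq_divide) simp
  have S0: "0 \<le> S n" for n using S(1)[of n] by simp
  define g where "g n = sigma_fun F\<^sub>T \<mu> F (S n)" for n
  define b where "b n = sigma_B F\<^sub>B (g n)" for n
  define x where "x n = lam * b n" for n
  define w where "w n = ln (1 + x n)" for n
  have LF: "laplace_stieltjes F (S n) = laplace_stieltjes F\<^sub>A (w n)" for n
    using fixpoint[OF S0] by (simp add: solution_map_def w_def x_def b_def g_def)
  have g: "0 \<le> g n" "g n \<le> \<mu> * S n" for n
    using sigma_fun_nonneg[OF F T S0] sigma_fun_le[OF F T S0] by (auto simp: g_def)
  have b: "0 \<le> b n" "b n \<le> g n" for n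
    using sigma_B_bounds[OF B g(1)] by (auto simp: b_def)
  have x: "0 \<le> x n" for n using b lam by (simp add: x_def)
  have w: "0 \<le> w n" "w n \<le> x n" for n using ln_one_plus_bounds[OF x] by (auto simp: w_def)
  (* w n = 0 would make the transform of F equal to 1 at S n > 0, but F has positive mean. *)
  have "w n \<noteq> 0" for n
    using LF[of n] laplace_less_1[OF F'(1,2) _ S(1)[of n]] laplace_0[OF A] F'(3) mu by auto
  then have pos: "0 < w n" "0 < x n" "0 < b n" "0 < g n" for n
    using w[of n] b[of n] lam by (force simp: x_def zero_less_mult_iff less_le)+
  have g_lim: "(\<lambda>n. g n / S n) \<longlonglongrightarrow> \<mu>"
    unfolding g_def by (rule sigma_fun_first_derivative[OF F T S])
  have gz: "g \<longlonglongrightarrow> 0"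
    using tendsto_mult[OF g_lim S(2)] S(1) by (simp add: less_imp_neq[THEN not_sym])
  have b_lim: "(\<lambda>n. b n / g n) \<longlonglongrightarrow> 1"
    using sigma_fun_first_derivative[OF moment_class_return_1 B pos(4) gz]
    by (simp add: b_def sigma_B_eq_sigma_fun[OF B] g)
  have bz: "b \<longlonglongrightarrow> 0"
    using tendsto_mult[OF b_lim gz] pos(4) by (simp add: less_imp_neq[THEN not_sym])
  have xz: "x \<longlonglongrightarrow> 0"
    using tendsto_mult[OF tendsto_const bz, of lam] by (simp add: x_def[abs_def])
  note xr = filterlim_at_right_0I[OF pos(2) xz]
  have "((\<lambda>u::real. ln (1 + u) / u) \<longlongrightarrow> 1) (at_right 0)" by real_asymp
  from filterlim_compose[OF this xr] have w_lim: "(\<lambda>n. w n / x n) \<longlonglongrightarrow> 1" by (simp add: w_def)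
  have wz: "w \<longlonglongrightarrow> 0"
    using tendsto_mult[OF w_lim xz] pos(2) by (simp add: less_imp_neq[THEN not_sym])
  have nz: "S n \<noteq> 0" "g n \<noteq> 0" "b n \<noteq> 0" "x n \<noteq> 0" "w n \<noteq> 0" for n
    using S(1)[of n] pos[of n] by auto
  have "(\<lambda>n. lam * (b n / g n * (g n / S n))) \<longlonglongrightarrow> lam * (1 * \<mu>)"
    by (intro tendsto_intros b_lim g_lim)
  then have xS: "(\<lambda>n. x n / S n) \<longlonglongrightarrow> lam * \<mu>" using nz by (simp add: x_def)
  have "(\<lambda>n. w n / x n * (x n / S n)) \<longlonglongrightarrow> 1 * (lam * \<mu>)"
    by (intro tendsto_intros w_lim xS)
  then have wS: "(\<lambda>n. w n / S n) \<longlonglongrightarrow> lam * \<mu>" using nz by simp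
  have lm: "lam * \<mu> \<noteq> 0" using lam mu by simp
  have "(\<lambda>n. (1 - laplace_stieltjes F (S n)) / S n / (w n / S n)) \<longlonglongrightarrow> \<mu> / (lam * \<mu>)"
    using laplace_first_derivative[OF F'(1) S F'(2)] lm unfolding F'(3) by (intro tendsto_intros wS)
  then have A_lim: "(\<lambda>n. (1 - laplace_stieltjes F\<^sub>A (w n)) / w n) \<longlonglongrightarrow> 1 / lam"
    using nz mu by (simp add: LF)
  have "eventually (\<lambda>n. (1 - laplace_stieltjes F\<^sub>A (w n)) / w n < 1 / lam + 1) sequentially"
    using order_tendstoD(2)[OF A_lim, of "1 / lam + 1"] by simp
  then have "eventually (\<lambda>n. (1 - laplace_stieltjes F\<^sub>A (w n)) / w n \<le> 1 / lam + 1) sequentially"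
    by eventually_elim simp
  then show intA: "integrable F\<^sub>A (\<lambda>a. a)"
    by (rule integrable_from_laplace[OF A pos(1) wz])
  show meanA: "(\<integral>a. a \<partial>F\<^sub>A) = 1 / lam"
    using laplace_first_derivative[OF A pos(1) wz intA] A_lim by (rule LIMSEQ_unique)
  define qA where "qA n = (laplace_stieltjes F\<^sub>A (w n) - 1 + 1 / lam * w n) / (w n)\<^sup>2" for n
  define qT where "qT n = (\<mu> * S n - g n) / (S n)\<^sup>2" for n
  define qB where "qB n = (1 * g n - b n) / (g n)\<^sup>2" for n
  define qL where "qL n = (x n - ln (1 + x n)) / (x n)\<^sup>2" for n
  define q where "q n = (laplace_stieltjes F (S n) - 1 + \<mu> * S n) / (S n)\<^sup>2" for n
  have nonneg: "0 \<le> qA n" "0 \<le> qT n" "0 \<le> qB n" "0 \<le> qL n" for n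
    using one_minus_laplace_le_mean[OF A intA w(1)[of n]] g[of n] b[of n] w[of n] meanA
    by (auto simp: qA_def qT_def qB_def qL_def w_def)
  have split: "q n = qA n * (w n / S n)\<^sup>2 + qT n + qB n * (g n / S n)\<^sup>2 + qL n * (x n / S n)\<^sup>2 / lam" for n
  proof -
    have "laplace_stieltjes F (S n) - 1 + \<mu> * S n =
       (laplace_stieltjes F\<^sub>A (w n) - 1 + 1 / lam * w n) + (\<mu> * S n - g n) + (1 * g n - b n) + (x n - ln (1 + x n)) / lam"
    proof -
      have "(x n - ln (1 + x n)) / lam = b n - w n / lam"
        using lam by (simp add: w_def x_def diff_divide_distrib)
      then show ?thesis by (simp add: LF)
    qed
    moreover have "qA n * (w n / S n)\<^sup>2 = (laplace_stieltjes F\<^sub>A (w n) - 1 + 1 / lam * w n) / (S n)\<^sup>2"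
      "qB n * (g n / S n)\<^sup>2 = (1 * g n - b n) / (S n)\<^sup>2"
      "qL n * (x n / S n)\<^sup>2 / lam = (x n - ln (1 + x n)) / lam / (S n)\<^sup>2"
      using nz[of n] by (simp_all add: qA_def qB_def qL_def power_divide)
    ultimately show ?thesis by (simp only: q_def qT_def add_divide_distrib)
  qed
  have qle: "q n \<le> K / 2" for n
    using moment_classD(5)[OF F S0, of n] S(1)[of n] by (simp add: q_def pos_divide_le_eq)
  have parts: "qA n * (w n / S n)\<^sup>2 \<le> K / 2" "qT n \<le> K / 2" "qB n * (g n / S n)\<^sup>2 \<le> K / 2" for n
  proof -
    have "0 \<le> qA n * (w n / S n)\<^sup>2" "0 \<le> qB n * (g n / S n)\<^sup>2" "0 \<le> qL n * (x n / S n)\<^sup>2 / lam"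
      using nonneg[of n] lam by auto
    with split[of n] qle[of n] nonneg(2)[of n]
    show "qA n * (w n / S n)\<^sup>2 \<le> K / 2" "qT n \<le> K / 2" "qB n * (g n / S n)\<^sup>2 \<le> K / 2" by linarith+
  qed
  show intT: "integrable F\<^sub>T (\<lambda>t. t)"
    by (rule integrable_from_sigma_fun[OF F T S mu, of "K / 2"]) (use parts(2) in \<open>simp add: qT_def g_def\<close>)
  (* The bound on r n * (z n / S n)^2 passes to r n since z n / S n has a positive limit. *)
  have bounded: "eventually (\<lambda>n. r n \<le> K / c\<^sup>2) sequentially"
    if lim: "(\<lambda>n. z n / S n) \<longlonglongrightarrow> c" and c: "0 < c" and r: "\<And>n. r n * (z n / S n)\<^sup>2 \<le> K / 2" "\<And>n. 0 \<le> r n"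
    for z r c
  proof -
    have "(\<lambda>n. (z n / S n)\<^sup>2) \<longlonglongrightarrow> c\<^sup>2" by (intro tendsto_intros lim)
    then have "eventually (\<lambda>n. c\<^sup>2 / 2 < (z n / S n)\<^sup>2) sequentially"
      by (rule order_tendstoD) (use c in simp)
    then show ?thesis
    proof eventually_elim
      case (elim n)
      have "r n * (c\<^sup>2 / 2) \<le> r n * (z n / S n)\<^sup>2" using elim r(2) by (intro mult_left_mono) auto
      then have "r n * c\<^sup>2 \<le> K" using r(1)[of n] by simp
      then show ?case using c by (simp add: pos_le_divide_eq)
    qed
  qed
  show intA2: "integrable F\<^sub>A (\<lambda>a. a\<^sup>2)"
  proof (rule square_integrable_from_laplace(1)[OF A intA pos(1) wz])
    show "eventually (\<lambda>n. (laplace_stieltjes F\<^sub>A (w n) - 1 + (\<integral>a. a \<partial>F\<^sub>A) * w n) / (w n)\<^sup>2 \<le> K / (lam * \<mu>)\<^sup>2) sequentially"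
      using bounded[OF wS _ parts(1) nonneg(1)] lam mu by (simp add: qA_def meanA)
  qed
  have qB_sigma: "qB n = (1 * g n - sigma_fun F\<^sub>B 1 (return borel 1) (g n)) / (g n)\<^sup>2" for n
    by (simp add: qB_def b_def sigma_B_eq_sigma_fun[OF B g(1)])
  show intB: "integrable F\<^sub>B (\<lambda>b. b)"
    by (rule integrable_from_sigma_fun[OF moment_class_return_1 B pos(4) gz, of "K / \<mu>\<^sup>2"])
      (use bounded[OF g_lim mu parts(3) nonneg(3)] qB_sigma in auto)
  have qA_lim: "qA \<longlonglongrightarrow> (\<integral>a. a\<^sup>2 \<partial>F\<^sub>A) / 2"
    using laplace_second_derivative[OF A intA intA2 pos(1) wz] by (simp add: qA_def[abs_def] meanA)
  have qT_lim: "qT \<longlonglongrightarrow> (\<integral>t. t \<partial>F\<^sub>T) * m2 / 2"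
    using sigma_fun_second_derivative[OF F T S intT] by (simp add: qT_def[abs_def] g_def m2_def)
  have "(\<integral>x. x\<^sup>2 \<partial>return borel (1::real)) = 1" by (subst integral_return) auto
  then have qB_lim: "qB \<longlonglongrightarrow> (\<integral>b. b \<partial>F\<^sub>B) / 2"
    using sigma_fun_second_derivative[OF moment_class_return_1 B pos(4) gz intB]
    by (simp add: qB_sigma[abs_def])
  have "((\<lambda>u::real. (u - ln (1 + u)) / u\<^sup>2) \<longlongrightarrow> 1 / 2) (at_right 0)" by real_asymp
  from filterlim_compose[OF this xr] have qL_lim: "qL \<longlonglongrightarrow> 1 / 2" by (simp add: qL_def[abs_def])
  have "q \<longlonglongrightarrow> m2 / 2"
    using laplace_second_derivative[OF F'(1,2,4) S] by (simp add: q_def[abs_def] m2_def F'(3))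
  moreover have "q \<longlonglongrightarrow> (\<integral>a. a\<^sup>2 \<partial>F\<^sub>A) / 2 * (lam * \<mu>)\<^sup>2 + (\<integral>t. t \<partial>F\<^sub>T) * m2 / 2
      + (\<integral>b. b \<partial>F\<^sub>B) / 2 * \<mu>\<^sup>2 + 1 / 2 * (lam * \<mu>)\<^sup>2 / lam"
    unfolding split[abs_def] using lam
    by (intro tendsto_intros qA_lim qT_lim qB_lim qL_lim wS g_lim xS) auto
  ultimately have "m2 / 2 = (\<integral>a. a\<^sup>2 \<partial>F\<^sub>A) / 2 * (lam * \<mu>)\<^sup>2 + (\<integral>t. t \<partial>F\<^sub>T) * m2 / 2
      + (\<integral>b. b \<partial>F\<^sub>B) / 2 * \<mu>\<^sup>2 + 1 / 2 * (lam * \<mu>)\<^sup>2 / lam"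
    by (rule LIMSEQ_unique)
  then show eq: "(\<integral>x. x\<^sup>2 \<partial>F) * (1 - (\<integral>t. t \<partial>F\<^sub>T)) = \<mu>\<^sup>2 * ((\<integral>b. b \<partial>F\<^sub>B) + lam + lam\<^sup>2 * (\<integral>a. a\<^sup>2 \<partial>F\<^sub>A))"
    unfolding m2_def[symmetric] using lam by (simp add: power2_eq_square field_simps)
  have "0 \<le> (\<integral>b. b \<partial>F\<^sub>B)" using nonneg_distributionD(4)[OF B] by (rule integral_nonneg_AE)
  moreover have "0 \<le> lam\<^sup>2 * (\<integral>a. a\<^sup>2 \<partial>F\<^sub>A)" by simp
  ultimately have "0 < (\<integral>b. b \<partial>F\<^sub>B) + lam + lam\<^sup>2 * (\<integral>a. a\<^sup>2 \<partial>F\<^sub>A)" using lam by linarith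
  then have "0 < (\<integral>x. x\<^sup>2 \<partial>F) * (1 - (\<integral>t. t \<partial>F\<^sub>T))" unfolding eq using mu by simp
  moreover have "0 \<le> (\<integral>x. x\<^sup>2 \<partial>F)" by simp
  ultimately show "(\<integral>t. t \<partial>F\<^sub>T) < 1" by (simp add: zero_less_mult_iff)
qed

end

section \<open>The characterization\<close>

lemma nonneg_rv_dist_transfer:
  fixes f :: "real \<Rightarrow> real"
  assumes M: "prob_space M" and X: "nonneg_rv_dist M X F"
  shows "nonneg_distribution F"
    "f \<in> borel_measurable borel \<Longrightarrow> integrable F f \<longleftrightarrow> integrable M (\<lambda>\<omega>. f (X \<omega>))"
    "f \<in> borel_measurable borel \<Longrightarrow> (\<integral>x. f x \<partial>F) = (\<integral>\<omega>. f (X \<omega>) \<partial>M)"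
proof -
  interpret prob_space M by fact
  have [measurable]: "X \<in> borel_measurable M" and nn: "AE \<omega> in M. 0 \<le> X \<omega>" and F: "F = distr M borel X"
    using X by (auto simp: nonneg_rv_dist_def)
  show "nonneg_distribution F"
    unfolding F by (intro nonneg_distributionI prob_space_distr) (auto simp: AE_distr_iff nn)
  show "f \<in> borel_measurable borel \<Longrightarrow> integrable F f \<longleftrightarrow> integrable M (\<lambda>\<omega>. f (X \<omega>))"
    unfolding F by (rule integrable_distr_eq) auto
  show "f \<in> borel_measurable borel \<Longrightarrow> (\<integral>x. f x \<partial>F) = (\<integral>\<omega>. f (X \<omega>) \<partial>M)"
    unfolding F by (rule integral_distr) auto
qed

theorem theorem2:
  fixes M :: "'a measure" and T A B :: "'a \<Rightarrow> real"
    and F\<^sub>T F\<^sub>A F\<^sub>B :: "real measure" and \<mu> lam :: real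
  assumes "prob_space M"
    and "0 < \<mu>" and "0 < lam"
    and "nonneg_rv_dist M T F\<^sub>T"
    and "nonneg_rv_dist M A F\<^sub>A"
    and "nonneg_rv_dist M B F\<^sub>B"
  shows
    "((integrable M T \<and> 0 \<le> prob_space.expectation M T \<and> prob_space.expectation M T < 1 \<and>
       integrable M A \<and> prob_space.expectation M A = 1 / lam \<and>
       integrable M (\<lambda>\<omega>. (A \<omega>)\<^sup>2) \<and>
       integrable M B \<and> 0 \<le> prob_space.expectation M B)
      \<longleftrightarrow> (\<exists>!F. is_solution F\<^sub>T F\<^sub>A F\<^sub>B lam \<mu> F)) \<and>
     ((\<exists>!F. is_solution F\<^sub>T F\<^sub>A F\<^sub>B lam \<mu> F) \<longrightarrow>
      (\<forall>F. is_solution F\<^sub>T F\<^sub>A F\<^sub>B lam \<mu> F \<longrightarrow>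
        prob_space.variance F (\<lambda>x. x) =
          (lam\<^sup>2 * prob_space.variance M A + lam + prob_space.expectation M B + prob_space.expectation M T)
          / (1 - prob_space.expectation M T) * \<mu>\<^sup>2))"
proof -
  interpret prob_space M by fact
  note T = nonneg_rv_dist_transfer[OF assms(1,4)]
  note A = nonneg_rv_dist_transfer[OF assms(1,5)]
  note B = nonneg_rv_dist_transfer[OF assms(1,6)]
  have trT: "integrable F\<^sub>T (\<lambda>t. t) \<longleftrightarrow> integrable M T" "(\<integral>t. t \<partial>F\<^sub>T) = expectation T"
    using T(2,3)[of "\<lambda>t. t"] by simp_all
  have trA: "integrable F\<^sub>A (\<lambda>a. a) \<longleftrightarrow> integrable M A" "(\<integral>a. a \<partial>F\<^sub>A) = expectation A"
    "integrable F\<^sub>A (\<lambda>a. a\<^sup>2) \<longleftrightarrow> integrable M (\<lambda>\<omega>. (A \<omega>)\<^sup>2)" "(\<integral>a. a\<^sup>2 \<partial>F\<^sub>A) = expectation (\<lambda>\<omega>. (A \<omega>)\<^sup>2)"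
    using A(2,3)[of "\<lambda>t. t"] A(2,3)[of "\<lambda>t. t\<^sup>2"] by simp_all
  have trB: "integrable F\<^sub>B (\<lambda>b. b) \<longleftrightarrow> integrable M B" "(\<integral>b. b \<partial>F\<^sub>B) = expectation B"
    using B(2,3)[of "\<lambda>t. t"] by simp_all
  have nonneg: "0 \<le> expectation T" "0 \<le> expectation B"
    using assms(4,6) by (auto simp: nonneg_rv_dist_def intro: integral_nonneg_AE)
  have nec: "(integrable M T \<and> expectation T < 1 \<and> integrable M A \<and> expectation A = 1 / lam \<and>
       integrable M (\<lambda>\<omega>. (A \<omega>)\<^sup>2) \<and> integrable M B) \<and>
       prob_space.variance F (\<lambda>x. x) = (lam\<^sup>2 * variance A + lam + expectation B + expectation T) / (1 - expectation T) * \<mu>\<^sup>2"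
    if sol: "is_solution F\<^sub>T F\<^sub>A F\<^sub>B lam \<mu> F" for F
  proof -
    obtain K where F: "moment_class \<mu> K F"
      and fixpoint: "\<And>s. 0 \<le> s \<Longrightarrow> laplace_stieltjes F s = solution_map F\<^sub>T F\<^sub>A F\<^sub>B lam \<mu> F s"
      using sol unfolding is_solution_iff[OF T(1) A(1) B(1) assms(3)] by blast
    note N = moments_from_solution[OF T(1) A(1) B(1) assms(3,2) F fixpoint, unfolded trT trA trB]
    have varA: "variance A = expectation (\<lambda>\<omega>. (A \<omega>)\<^sup>2) - (1 / lam)\<^sup>2"
      using variance_eq[OF N(3,5)] N(4) by simp
    have "(\<integral>x. x \<partial>F) = \<mu>" using F by (simp add: moment_class_def)
    then have "prob_space.variance F (\<lambda>x. x) = (\<integral>x. x\<^sup>2 \<partial>F) - \<mu>\<^sup>2"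
      using moment_class_variance(2)[OF F] by simp
    moreover have "(\<integral>x. x\<^sup>2 \<partial>F) = \<mu>\<^sup>2 * (expectation B + lam + lam\<^sup>2 * expectation (\<lambda>\<omega>. (A \<omega>)\<^sup>2)) / (1 - expectation T)"
      using N(2,7) by (simp add: eq_divide_eq)
    moreover have "lam\<^sup>2 * variance A = lam\<^sup>2 * expectation (\<lambda>\<omega>. (A \<omega>)\<^sup>2) - 1"
      unfolding varA using assms(3) by (simp add: right_diff_distrib power_divide)
    moreover have "(c - (1 - expectation T)) / (1 - expectation T) * \<mu>\<^sup>2 = \<mu>\<^sup>2 * c / (1 - expectation T) - \<mu>\<^sup>2" for c
    proof -
      have "(c - (1 - expectation T)) / (1 - expectation T) = c / (1 - expectation T) - 1"
        using N(2) by (simp add: diff_divide_distrib)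
      then show ?thesis by (simp add: right_diff_distrib mult.commute)
    qed
    moreover have "lam\<^sup>2 * expectation (\<lambda>\<omega>. (A \<omega>)\<^sup>2) - 1 + lam + expectation B + expectation T
        = (expectation B + lam + lam\<^sup>2 * expectation (\<lambda>\<omega>. (A \<omega>)\<^sup>2)) - (1 - expectation T)" by simp
    ultimately have "prob_space.variance F (\<lambda>x. x) = (lam\<^sup>2 * variance A + lam + expectation B + expectation T) / (1 - expectation T) * \<mu>\<^sup>2"
      by (simp only:)
    with N show ?thesis by blast
  qed
  have "\<exists>!F. is_solution F\<^sub>T F\<^sub>A F\<^sub>B lam \<mu> F"
    if "integrable M T" "expectation T < 1" "integrable M A" "expectation A = 1 / lam"
      "integrable M (\<lambda>\<omega>. (A \<omega>)\<^sup>2)" "integrable M B"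
    using ex1_solution[OF T(1) A(1) B(1) assms(3,2), unfolded trT trA trB] that by blast
  with nec nonneg show ?thesis by blast
qed

end
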